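(* Let $F$ be an oriented surface. Let $\tau_i$ be the map which swaps the labels $i$ and $i+1$ in a chord diagram with enumerated core circles. Then $\tau_i\circ\mu_i=-\mu_i$.
   Context: Chord diagrams: a chord diagram is a disjoint union of oriented circles (core circles) together with disjoint arcs (chords) whose endpoints are distinct points on the core circles (the chords meet the circles only in their endpoints). A geometrical chord diagram on $F$ is a smooth map from a chord diagram to $F$ sending each chord to a point; a chord diagram on $F$ is a homotopy class $[D]$ of a geometrical chord diagram $D$ (through geometrical chord diagrams). Chords here are unoriented, and core circles are labelled by $1,\dots,n$, where $n$ is the number of core circles. A chord is external if its endpoints lie on distinct core circles. $M_e$ is the free $\mathbb Z$-module generated by chord diagrams on $F$ all of whose chords are external. $N_e\subset M_e$ is the submodule generated by the relations $D=D'$ of the following two kinds (with all choices of orientations of the branches): let $c$ be an external chord with endpoints $x$ and $y$ on two core circles and let another external chord $d$ have an endpoint $z$ adjacent to $x$ on the core circle of $x$ (so that near this place everything is mapped to one point of $F$, through which the branches pass); then (1) $z$ may be slid past $x$ to the other side of $x$ on the same core circle, and (2) $z$ may be slid along $c$ from the core circle of $x$ to the core circle of $y$, to a position adjacent to $y$ (whenever the resulting diagram has only external chords). Set $ch_e=M_e/N_e$. Splitting: let $a:C_i\to F$ be the restriction of a geometrical chord diagram $D$ (in general position) to the $i$-th core circle. For a self-intersection point $(t_1,t_2)$ of $a$ with $p=a(t_1)=a(t_2)$, $t_1\ne t_2$ (unordered pair), let $a^1_p,a^2_p$ be the two loops $a([t_1,t_2])$ and $a([t_2,t_1])$ based at $p$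 (arcs taken in the direction of the orientation of $C_i$), named so that the ordered pair of their initial tangent vectors at $p$ gives the orientation of $T_pF$. $\mathcal{SI}^i_0$ is the set of self-intersection points of the $i$-th core circle for which neither $a^1_p$ nor $a^2_p$ is homotopically trivial. $D_p$ is $D$ with a chord added between $t_1$ and $t_2$. $S_p^{+}(D_p)$ (resp. $S_p^-(D_p)$) is obtained by splitting the $i$-th core circle at $t_1,t_2$ into two new core circles joined by the (unoriented) added chord mapped to $p$, other chord endpoints being carried along: in $S_p^+$ the circle mapped to $a^1_p$ is labelled $i$ and the circle mapped to $a^2_p$ is labelled $i+1$; in $S_p^-$ the circle mapped to $a^1_p$ is labelled $i+1$ and the circle mapped to $a^2_p$ is labelled $i$. In both cases labels formerly $\geq i+1$ are increased by one. For a chord diagram $\mathcal D=[D]$ with only external chords and a core circle labelled $i$, $\mu_i(\mathcal D)=\sum_{p\in\mathcal{SI}^i_0}\big([S^+_p(D_p)]-[S^-_p(D_p)]\big)\in ch_e$, extended linearly; this is well defined on $ch_e$. *)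

theory Defs
  imports
    "HOL-Analysis.Analysis"
    "HOL-Algebra.Free_Abelian_Groups"
    "HOL-Algebra.Generated_Groups"
    "HOL-Algebra.Coset"
    "HOL-Combinatorics.Transposition"
begin

section \<open>Smooth oriented surfaces\<close>

text \<open>\<open>C_k k S f\<close> is meant for open \<open>S\<close>, where it says that \<open>f\<close> is \<open>k\<close> times continuously
  differentiable on \<open>S\<close>.\<close>

primrec C_k :: "nat \<Rightarrow> 'a::euclidean_space set \<Rightarrow> ('a \<Rightarrow> 'b::euclidean_space) \<Rightarrow> bool" where
  "C_k 0 S f \<longleftrightarrow> continuous_on S f"
| "C_k (Suc k) S f \<longleftrightarrow>
     (\<exists>f'. (\<forall>x\<in>S. (f has_derivative f' x) (at x)) \<and> (\<forall>v. C_k k S (\<lambda>x. f' x v)))"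

definition smooth_on :: "'a::euclidean_space set \<Rightarrow> ('a \<Rightarrow> 'b::euclidean_space) \<Rightarrow> bool" where
  "smooth_on S f \<longleftrightarrow> (\<forall>k. C_k k S f)"

type_synonym 'f atlas = "('f set \<times> ('f \<Rightarrow> real^2)) set"

text \<open>The orientation is carried by the atlas: its charts are the positively oriented ones, so all
  transition maps have positive Jacobian determinant.  Neither compactness nor connectedness is
  required.\<close>

definition oriented_surface :: "'f topology \<Rightarrow> 'f atlas \<Rightarrow> bool" where
  "oriented_surface F A \<longleftrightarrow>
     Hausdorff_space F \<and> second_countable F \<and>
     (\<forall>(U, \<psi>)\<in>A. openin F U \<and> open (\<psi> ` U) \<and>
        homeomorphic_map (subtopology F U) (top_of_set (\<psi> ` U)) \<psi>) \<and>
     (\<Union>(U, \<psi>)\<in>A. U) = topspace F \<and>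
     (\<forall>(U, \<psi>)\<in>A. \<forall>(V, \<phi>)\<in>A.
        smooth_on (\<psi> ` (U \<inter> V)) (\<phi> \<circ> inv_into U \<psi>) \<and>
        (\<forall>w\<in>\<psi> ` (U \<inter> V). det (matrix (frechet_derivative (\<phi> \<circ> inv_into U \<psi>) (at w))) > 0))"

abbreviation circle :: "complex set" where
  "circle \<equiv> sphere 0 1"

definition smooth_loop :: "'f topology \<Rightarrow> 'f atlas \<Rightarrow> (complex \<Rightarrow> 'f) \<Rightarrow> bool" where
  "smooth_loop F A a \<longleftrightarrow>
     continuous_map (top_of_set circle) F a \<and>
     (\<forall>(U, \<psi>)\<in>A. smooth_on {t. a (cis t) \<in> U} (\<lambda>t. \<psi> (a (cis t))))"

definition null_homotopic :: "'f topology \<Rightarrow> (complex \<Rightarrow> 'f) \<Rightarrow> bool" where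
  "null_homotopic F a \<longleftrightarrow>
     (\<exists>p. homotopic_with (\<lambda>_. True) (top_of_set circle) F a (\<lambda>_. p))"

text \<open>The velocity of \<open>a\<close> at \<open>x\<close>, read in the chart \<open>\<psi>\<close>.\<close>

definition velocity :: "('f \<Rightarrow> real^2) \<Rightarrow> (complex \<Rightarrow> 'f) \<Rightarrow> complex \<Rightarrow> real^2" where
  "velocity \<psi> a x = vector_derivative (\<lambda>s. \<psi> (a (x * cis s))) (at 0)"


section \<open>Chord diagrams on a surface\<close>

text \<open>Every core circle is the unit circle with its counterclockwise orientation; the point \<open>z\<close> of
  the core circle labelled \<open>j\<close> is the pair \<open>(j, z)\<close>.  An unoriented chord is encoded by the set of
  its two endpoints: since a geometrical chord diagram is constant on each chord, it is determined
  by its values on the core circles.  Values of \<open>cmap\<close> off the core circles are irrelevant.\<close>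

type_synonym point = "nat \<times> complex"

record 'f diagram =
  ncirc :: nat
  chords :: "point set set"
  cmap :: "point \<Rightarrow> 'f"

definition points :: "nat \<Rightarrow> point set" where
  "points n = {1..n} \<times> circle"

definition chord_system :: "nat \<Rightarrow> point set set \<Rightarrow> bool" where
  "chord_system n C \<longleftrightarrow>
     finite C \<and> (\<forall>c\<in>C. c \<subseteq> points n \<and> card c = 2) \<and> pairwise disjnt C"

definition geometrical :: "'f topology \<Rightarrow> 'f atlas \<Rightarrow> 'f diagram \<Rightarrow> bool" where
  "geometrical F A D \<longleftrightarrow>
     chord_system (ncirc D) (chords D) \<and>
     (\<forall>j\<in>{1..ncirc D}. smooth_loop F A (\<lambda>z. cmap D (j, z))) \<and>
     (\<forall>c\<in>chords D. \<forall>u\<in>c. \<forall>v\<in>c. cmap D u = cmap D v)"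

text \<open>A homotopy moves the map and, the underlying chord diagram being given only up to
  isomorphism, it may also move the chord endpoints: \<open>e t u\<close> is the position at time \<open>t\<close> of the
  endpoint that starts at \<open>u\<close>.  Endpoints stay distinct, and every stage is a geometrical chord
  diagram.  (\<open>nat\<close> is discrete, so an endpoint stays on its core circle.)\<close>

definition homotopic_diagrams ::
  "'f topology \<Rightarrow> 'f atlas \<Rightarrow> 'f diagram \<Rightarrow> 'f diagram \<Rightarrow> bool" where
  "homotopic_diagrams F A D D' \<longleftrightarrow>
     ncirc D' = ncirc D \<and>
     (\<exists>H e.
        (\<forall>t\<in>{0..1::real}. inj_on (e t) (\<Union>(chords D)) \<and>
           geometrical F A \<lparr>ncirc = ncirc D, chords = (`) (e t) ` chords D, cmap = H t\<rparr>) \<and>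
        (\<forall>u\<in>\<Union>(chords D). continuous_on {0..1} (\<lambda>t. e t u)) \<and>
        (\<forall>j\<in>{1..ncirc D}.
           continuous_map (prod_topology (top_of_set {0..1}) (top_of_set circle)) F
             (\<lambda>(t, z). H t (j, z))) \<and>
        (\<forall>u\<in>\<Union>(chords D). e 0 u = u) \<and>
        (\<forall>u\<in>points (ncirc D). H 0 u = cmap D u) \<and>
        (`) (e 1) ` chords D = chords D' \<and>
        (\<forall>u\<in>points (ncirc D). H 1 u = cmap D' u))"

type_synonym 'f chord_diagram = "'f diagram set"

definition diagram_class ::
  "'f topology \<Rightarrow> 'f atlas \<Rightarrow> 'f diagram \<Rightarrow> 'f chord_diagram" where
  "diagram_class F A D = {D'. homotopic_diagrams F A D D'}"

definition external :: "point set \<Rightarrow> bool" where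
  "external c \<longleftrightarrow> inj_on fst c"

definition ext_geometrical :: "'f topology \<Rightarrow> 'f atlas \<Rightarrow> 'f diagram \<Rightarrow> bool" where
  "ext_geometrical F A D \<longleftrightarrow> geometrical F A D \<and> (\<forall>c\<in>chords D. external c)"


section \<open>The module of chord diagrams with external chords\<close>

definition M_e :: "'f topology \<Rightarrow> 'f atlas \<Rightarrow> ('f chord_diagram \<Rightarrow>\<^sub>0 int) monoid" where
  "M_e F A = free_Abelian_group {diagram_class F A D | D. ext_geometrical F A D}"

definition ccw_arc :: "complex \<Rightarrow> complex \<Rightarrow> complex set" where
  "ccw_arc u v = {u * cis s | s. 0 \<le> s \<and> s \<le> Arg2pi (v / u)}"

text \<open>The two closed arcs of the circle between \<open>u\<close> and \<open>v\<close>.\<close>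

definition arcs :: "complex \<Rightarrow> complex \<Rightarrow> complex set set" where
  "arcs u v = {ccw_arc u v, ccw_arc v u}"

definition move_endpoint :: "'f diagram \<Rightarrow> point set \<Rightarrow> point \<Rightarrow> point \<Rightarrow> 'f diagram" where
  "move_endpoint D d u v = D\<lparr>chords := insert (insert v (d - {u})) (chords D - {d})\<rparr>"

text \<open>In both relations \<open>c\<close> joins \<open>(j, x)\<close> to \<open>(k, y)\<close> and \<open>(j, z)\<close> is an endpoint of \<open>d\<close> adjacent to
  \<open>(j, x)\<close>; the representative is chosen so that the arcs involved in the slide are mapped to the
  single point \<open>cmap D (j, x) = cmap D (k, y)\<close> (such arcs are allowed: the map is smooth, but
  not required to be an immersion).\<close>

definition slide_past :: "'f diagram \<Rightarrow> 'f diagram \<Rightarrow> bool" where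
  "slide_past D D' \<longleftrightarrow>
     (\<exists>c\<in>chords D. \<exists>d\<in>chords D. \<exists>j x z z'. \<exists>B\<in>arcs z z'.
        c \<noteq> d \<and> (j, x) \<in> c \<and> (j, z) \<in> d \<and> z' \<in> circle \<and> z' \<noteq> x \<and> z' \<noteq> z \<and>
        \<Union>(chords D) \<inter> ({j} \<times> B) = {(j, x), (j, z)} \<and>
        (\<forall>w\<in>B. cmap D (j, w) = cmap D (j, x)) \<and>
        D' = move_endpoint D d (j, z) (j, z'))"

definition slide_along :: "'f diagram \<Rightarrow> 'f diagram \<Rightarrow> bool" where
  "slide_along D D' \<longleftrightarrow>
     (\<exists>c\<in>chords D. \<exists>d\<in>chords D. \<exists>j x z k y z'. \<exists>B\<in>arcs x z. \<exists>B'\<in>arcs y z'.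
        c \<noteq> d \<and> c = {(j, x), (k, y)} \<and> j \<noteq> k \<and> (j, z) \<in> d \<and> z' \<in> circle \<and> z' \<noteq> y \<and>
        \<Union>(chords D) \<inter> ({j} \<times> B) = {(j, x), (j, z)} \<and>
        \<Union>(chords D) \<inter> ({k} \<times> B') = {(k, y)} \<and>
        (\<forall>w\<in>B. cmap D (j, w) = cmap D (j, x)) \<and>
        (\<forall>w\<in>B'. cmap D (k, w) = cmap D (k, y)) \<and>
        D' = move_endpoint D d (j, z) (k, z'))"

definition N_e :: "'f topology \<Rightarrow> 'f atlas \<Rightarrow> ('f chord_diagram \<Rightarrow>\<^sub>0 int) set" where
  "N_e F A = generate (M_e F A)
     {frag_of (diagram_class F A D) - frag_of (diagram_class F A D') | D D'.
        ext_geometrical F A D \<and> ext_geometrical F A D' \<and> (slide_past D D' \<or> slide_along D D')}"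

definition ch_e :: "'f topology \<Rightarrow> 'f atlas \<Rightarrow> ('f chord_diagram \<Rightarrow>\<^sub>0 int) set monoid" where
  "ch_e F A = M_e F A Mod N_e F A"


section \<open>Splitting a core circle at a self-intersection point\<close>

text \<open>An increasing bijection of the unit interval all of whose derivatives vanish at the ends.  It
  serves to parametrise the two loops at a self-intersection point as smooth maps of a circle,
  although their images have a corner.\<close>

definition smooth_step :: "real \<Rightarrow> real" where
  "smooth_step s =
     (let h = (\<lambda>r::real. if r \<le> 0 then 0 else exp (- 1 / r)) in h s / (h s + h (1 - s)))"

text \<open>As \<open>z\<close> goes once around the circle starting from \<open>1\<close>, \<open>arc_point x y z\<close> goes
  counterclockwise from \<open>x\<close> to \<open>y\<close>.\<close>

definition arc_point :: "complex \<Rightarrow> complex \<Rightarrow> complex \<Rightarrow> complex" where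
  "arc_point x y z = x * cis (Arg2pi (y / x) * smooth_step (Arg2pi z / (2 * pi)))"

definition arc_loop :: "'f diagram \<Rightarrow> nat \<Rightarrow> complex \<Rightarrow> complex \<Rightarrow> complex \<Rightarrow> 'f" where
  "arc_loop D i x y z = cmap D (i, arc_point x y z)"

text \<open>The point of the original diagram from which a point of the split diagram comes.\<close>

definition unsplit_point :: "nat \<Rightarrow> complex \<Rightarrow> complex \<Rightarrow> point \<Rightarrow> point" where
  "unsplit_point i x y = (\<lambda>(j, z).
     if j < i then (j, z)
     else if j = i then (i, arc_point x y z)
     else if j = i + 1 then (i, arc_point y x z)
     else (j - 1, z))"

text \<open>Circle \<open>i\<close> is split at \<open>x\<close> and \<open>y\<close>: the arc from \<open>x\<close> to \<open>y\<close> becomes the circle labelled \<open>i\<close>,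
  the arc from \<open>y\<close> to \<open>x\<close> the one labelled \<open>i + 1\<close>, and the added chord joins their base points.\<close>

definition split_diagram :: "'f diagram \<Rightarrow> nat \<Rightarrow> complex \<Rightarrow> complex \<Rightarrow> 'f diagram" where
  "split_diagram D i x y =
     \<lparr>ncirc = ncirc D + 1,
      chords = insert {(i, 1), (i + 1, 1)}
        {c. c \<subseteq> points (ncirc D + 1) \<and> card c = 2 \<and> unsplit_point i x y ` c \<in> chords D},
      cmap = cmap D \<circ> unsplit_point i x y\<rparr>"

text \<open>General position: the core circles are immersed, with only transverse double points and no
  triple points.  In particular the preimages of a self-intersection point of a core circle are not
  endpoints of external chords.\<close>

definition general_position :: "'f atlas \<Rightarrow> 'f diagram \<Rightarrow> bool" where
  "general_position A D \<longleftrightarrow>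
     (\<forall>(j, x)\<in>points (ncirc D). \<forall>(U, \<psi>)\<in>A.
        cmap D (j, x) \<in> U \<longrightarrow> velocity \<psi> (\<lambda>w. cmap D (j, w)) x \<noteq> 0) \<and>
     (\<forall>(j, x)\<in>points (ncirc D). \<forall>(k, y)\<in>points (ncirc D). \<forall>(U, \<psi>)\<in>A.
        (j, x) \<noteq> (k, y) \<and> cmap D (j, x) = cmap D (k, y) \<and> cmap D (j, x) \<in> U \<longrightarrow>
        det (vector [velocity \<psi> (\<lambda>w. cmap D (j, w)) x,
                     velocity \<psi> (\<lambda>w. cmap D (k, w)) y] :: real^2^2) \<noteq> 0) \<and>
     (\<forall>u\<in>points (ncirc D). \<forall>v\<in>points (ncirc D). \<forall>w\<in>points (ncirc D).
        u \<noteq> v \<and> v \<noteq> w \<and> u \<noteq> w \<longrightarrow> \<not> (cmap D u = cmap D v \<and> cmap D v = cmap D w))"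

text \<open>In general position, exactly one of the two orderings \<open>(x, y)\<close> of the preimages of a
  self-intersection point \<open>p\<close> has positively oriented pair of velocities.  The unordered pair is
  represented by this ordering, so that the first loop \<open>a\<^sup>1\<^sub>p\<close> is the arc from \<open>x\<close> to \<open>y\<close> and the
  second loop \<open>a\<^sup>2\<^sub>p\<close> the arc from \<open>y\<close> to \<open>x\<close>.\<close>

definition self_intersections ::
  "'f atlas \<Rightarrow> 'f diagram \<Rightarrow> nat \<Rightarrow> (complex \<times> complex) set" where
  "self_intersections A D i =
     {(x, y). i \<in> {1..ncirc D} \<and> x \<in> circle \<and> y \<in> circle \<and> x \<noteq> y \<and>
        cmap D (i, x) = cmap D (i, y) \<and>
        (\<exists>(U, \<psi>)\<in>A. cmap D (i, x) \<in> U \<and>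
           det (vector [velocity \<psi> (\<lambda>w. cmap D (i, w)) x,
                        velocity \<psi> (\<lambda>w. cmap D (i, w)) y] :: real^2^2) > 0)}"

definition SI\<^sub>0 ::
  "'f topology \<Rightarrow> 'f atlas \<Rightarrow> 'f diagram \<Rightarrow> nat \<Rightarrow> (complex \<times> complex) set" where
  "SI\<^sub>0 F A D i =
     {(x, y) \<in> self_intersections A D i.
        \<not> null_homotopic F (arc_loop D i x y) \<and> \<not> null_homotopic F (arc_loop D i y x)}"

definition S_plus :: "'f diagram \<Rightarrow> nat \<Rightarrow> complex \<Rightarrow> complex \<Rightarrow> 'f diagram" where
  "S_plus D i x y = split_diagram D i x y"

definition S_minus :: "'f diagram \<Rightarrow> nat \<Rightarrow> complex \<Rightarrow> complex \<Rightarrow> 'f diagram" where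
  "S_minus D i x y = split_diagram D i y x"


section \<open>The operations \<open>\<mu>\<^sub>i\<close> and \<open>\<tau>\<^sub>i\<close>\<close>

definition mu_diagram ::
  "'f topology \<Rightarrow> 'f atlas \<Rightarrow> nat \<Rightarrow> 'f diagram \<Rightarrow> ('f chord_diagram \<Rightarrow>\<^sub>0 int)" where
  "mu_diagram F A i D =
     (\<Sum>(x, y)\<in>SI\<^sub>0 F A D i.
        frag_of (diagram_class F A (S_plus D i x y)) -
        frag_of (diagram_class F A (S_minus D i x y)))"

text \<open>The value on a homotopy class is computed on any of its representatives in general position;
  the class in \<open>ch_e\<close> does not depend on which one.  Such a representative always exists, so the
  \<open>else\<close> branch is never taken.  On diagrams without a core circle labelled \<open>i\<close>, where the
  operation is not defined, the value is \<open>0\<close> because \<open>SI\<^sub>0 F A D i\<close> is empty.\<close>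

definition mu_class ::
  "'f topology \<Rightarrow> 'f atlas \<Rightarrow> nat \<Rightarrow> 'f chord_diagram \<Rightarrow> ('f chord_diagram \<Rightarrow>\<^sub>0 int)" where
  "mu_class F A i \<D> =
     (if \<exists>D\<in>\<D>. general_position A D
      then mu_diagram F A i (SOME D. D \<in> \<D> \<and> general_position A D) else 0)"

text \<open>The map induced on \<open>ch_e\<close>; by well-definedness the choice of the representative in the coset
  is immaterial.\<close>

definition mu ::
  "'f topology \<Rightarrow> 'f atlas \<Rightarrow> nat \<Rightarrow>
    ('f chord_diagram \<Rightarrow>\<^sub>0 int) set \<Rightarrow> ('f chord_diagram \<Rightarrow>\<^sub>0 int) set" where
  "mu F A i X = N_e F A #>\<^bsub>M_e F A\<^esub> frag_extend (mu_class F A i) (SOME m. m \<in> X)"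

text \<open>Diagrams with fewer than \<open>i + 1\<close> core circles are left unchanged.\<close>

definition swap_labels :: "nat \<Rightarrow> 'f diagram \<Rightarrow> 'f diagram" where
  "swap_labels i D =
     (if i + 1 \<le> ncirc D
      then \<lparr>ncirc = ncirc D,
            chords = (`) (map_prod (Transposition.transpose i (i + 1)) id) ` chords D,
            cmap = cmap D \<circ> map_prod (Transposition.transpose i (i + 1)) id\<rparr>
      else D)"

text \<open>The image of a class (resp. coset) under relabelling is again a class (resp. coset).\<close>

definition tau_class :: "nat \<Rightarrow> 'f chord_diagram \<Rightarrow> 'f chord_diagram" where
  "tau_class i \<D> = swap_labels i ` \<D>"

definition tau ::
  "nat \<Rightarrow> ('f chord_diagram \<Rightarrow>\<^sub>0 int) set \<Rightarrow> ('f chord_diagram \<Rightarrow>\<^sub>0 int) set" where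
  "tau i X = frag_extend (\<lambda>\<D>. frag_of (tau_class i \<D>)) ` X"

end

theory Submission
  imports Defs
begin

text \<open>
  Both \<open>S\<^sup>+\<^sub>p(D\<^sub>p)\<close> and \<open>S\<^sup>-\<^sub>p(D\<^sub>p)\<close> arise by splitting the \<open>i\<close>-th core circle at the same two points, and
  they differ exactly by exchanging the labels \<open>i\<close> and \<open>i + 1\<close> of the two new circles.  So \<open>\<tau>\<^sub>i\<close>
  negates every summand of \<open>\<mu>\<^sub>i\<close> already in the free module, and it preserves \<open>N\<^sub>e\<close> because homotopies
  and slides can be relabelled.  The identity passes to the quotient as soon as the split diagrams
  lie in \<open>M\<^sub>e\<close>.  There the only analytic point is that the two loops are smooth despite their
  corners: the flat reparametrisation makes all their derivatives vanish at the base point.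
  General position excludes triple points, so no chord of \<open>D\<close> ends at the base points.
\<close>

section \<open>Calculus of the classes \<open>C_k\<close>\<close>

lemma C_k_SucE:
  assumes "C_k (Suc k) S f"
  obtains f' where "\<And>x. x \<in> S \<Longrightarrow> (f has_derivative f' x) (at x)"
    "\<And>v. C_k k S (\<lambda>x. f' x v)"
  using assms by auto

text \<open>Openness of \<open>S\<close> makes every point of \<open>S\<close> have a neighbourhood
  on which \<open>f\<close> and \<open>g\<close> agree, so the derivatives at that point agree as
  well.\<close>

lemma C_k_cong:
  assumes "open S" "\<And>x. x \<in> S \<Longrightarrow> f x = g x" "C_k k S f"
  shows "C_k k S g"
proof (cases k)
  case 0
  then show ?thesis using assms by (simp cong: continuous_on_cong)
next
  case (Suc m)
  with assms(3) obtain f' where f': "\<And>x. x \<in> S \<Longrightarrow> (f has_derivative f' x) (at x)"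
    "\<And>v. C_k m S (\<lambda>x. f' x v)" by auto
  have "(g has_derivative f' x) (at x)" if "x \<in> S" for x
    using has_derivative_transform_within_open[OF f'(1)[OF that] assms(1) that assms(2)] by simp
  with f'(2) Suc show ?thesis by auto
qed

lemma C_k_subset: "C_k k S f \<Longrightarrow> T \<subseteq> S \<Longrightarrow> C_k k T f"
proof (induction k arbitrary: f)
  case 0
  then show ?case by (auto intro: continuous_on_subset)
next
  case (Suc k)
  then show ?case by (simp add: subset_iff) metis
qed

text \<open>Different neighbourhoods come with unrelated witnesses for the derivative. By uniqueness
  each of them equals \<open>frechet_derivative\<close>, so this canonical choice serves on all of
  \<open>S\<close> at once. Smoothness of the loops of a split diagram can then be checked near one
  parameter at a time.\<close>

lemma C_k_local:
  assumes "\<And>x. x \<in> S \<Longrightarrow> \<exists>T. open T \<and> x \<in> T \<and> C_k k T f"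
  shows "C_k k S f"
  using assms
proof (induction k arbitrary: f)
  case 0
  have "isCont f x" if "x \<in> S" for x
    using 0[OF that] by (auto simp: continuous_on_eq_continuous_at)
  then show ?case by (simp add: continuous_at_imp_continuous_on)
next
  case (Suc k)
  let ?f' = "\<lambda>x. frechet_derivative f (at x)"
  have loc: "\<exists>T. open T \<and> x \<in> T \<and> (f has_derivative ?f' x) (at x) \<and> (\<forall>v. C_k k T (\<lambda>x. ?f' x v))"
    if x: "x \<in> S" for x
  proof -
    obtain T f' where T: "open T" "x \<in> T" "\<And>y. y \<in> T \<Longrightarrow> (f has_derivative f' y) (at y)"
      and f': "\<And>v. C_k k T (\<lambda>y. f' y v)"
      using Suc.prems[OF x] by auto
    have eq: "f' y = ?f' y" if "y \<in> T" for y
      using frechet_derivative_at[OF T(3)[OF that]] .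
    then have "C_k k T (\<lambda>x. ?f' x v)" for v
      by (intro C_k_cong[OF T(1) _ f'[of v]]) simp
    with T eq show ?thesis by metis
  qed
  then have "C_k k S (\<lambda>x. ?f' x v)" for v
    by (intro Suc.IH) metis
  with loc show ?case by (auto intro!: exI[of _ ?f'])
qed

lemma C_k_Suc_intro:
  assumes "\<And>x. x \<in> S \<Longrightarrow> (f has_derivative f' x) (at x)" "\<And>v. C_k k S (\<lambda>x. f' x v)"
  shows "C_k (Suc k) S f"
  unfolding C_k.simps using assms by (intro exI[of _ f']) simp

text \<open>The product and chain rules leave undifferentiated factors beside the derivatives; this
  lowers those factors to the order of the induction hypothesis.\<close>

lemma C_k_lower: "C_k (Suc k) S f \<Longrightarrow> C_k k S f"
proof (induction k arbitrary: f)
  case 0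
  then obtain f' where "\<And>x. x \<in> S \<Longrightarrow> (f has_derivative f' x) (at x)"
    using C_k_SucE by blast
  then show ?case
    using has_derivative_continuous by (fastforce intro!: continuous_at_imp_continuous_on)
next
  case (Suc k)
  obtain f' where "\<And>x. x \<in> S \<Longrightarrow> (f has_derivative f' x) (at x)"
    "\<And>v. C_k (Suc k) S (\<lambda>x. f' x v)" using C_k_SucE[OF Suc.prems] by blast
  with Suc.IH show ?case by (intro C_k_Suc_intro) blast+
qed

lemma C_k_const: "C_k k S (\<lambda>x. c)"
  by (induction k arbitrary: c) (auto intro!: exI[of _ "\<lambda>_ _. 0"])

lemma C_k_add: "C_k k S f \<Longrightarrow> C_k k S g \<Longrightarrow> C_k k S (\<lambda>x. f x + g x)"
proof (induction k arbitrary: f g)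
  case 0
  then show ?case by (auto intro: continuous_intros)
next
  case (Suc k)
  obtain f' where f': "\<And>x. x \<in> S \<Longrightarrow> (f has_derivative f' x) (at x)" "\<And>v. C_k k S (\<lambda>x. f' x v)"
    using C_k_SucE[OF Suc.prems(1)] by blast
  obtain g' where g': "\<And>x. x \<in> S \<Longrightarrow> (g has_derivative g' x) (at x)" "\<And>v. C_k k S (\<lambda>x. g' x v)"
    using C_k_SucE[OF Suc.prems(2)] by blast
  note d = f'(1) g'(1) and c = f'(2) g'(2)
  show ?case unfolding C_k.simps
    by (rule exI[of _ "\<lambda>x v. f' x v + g' x v"])
      (auto intro!: derivative_intros d c Suc.IH)
qed

lemma C_k_scaleR:
  "C_k k S f \<Longrightarrow> C_k k S g \<Longrightarrow> C_k k S (\<lambda>x. (f x :: real) *\<^sub>R g x)"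
proof (induction k arbitrary: f g)
  case 0
  then show ?case by (auto intro: continuous_intros)
next
  case (Suc k)
  obtain f' where f': "\<And>x. x \<in> S \<Longrightarrow> (f has_derivative f' x) (at x)" "\<And>v. C_k k S (\<lambda>x. f' x v)"
    using C_k_SucE[OF Suc.prems(1)] by blast
  obtain g' where g': "\<And>x. x \<in> S \<Longrightarrow> (g has_derivative g' x) (at x)" "\<And>v. C_k k S (\<lambda>x. g' x v)"
    using C_k_SucE[OF Suc.prems(2)] by blast
  note d = f'(1) g'(1) and c = f'(2) g'(2)
  show ?case unfolding C_k.simps
    by (rule exI[of _ "\<lambda>x v. f x *\<^sub>R g' x v + f' x v *\<^sub>R g x"])
      (simp add: d has_derivative_scaleR
        C_k_add[OF Suc.IH[OF C_k_lower[OF Suc.prems(1)] c(2)]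
          Suc.IH[OF c(1) C_k_lower[OF Suc.prems(2)]]])
qed

lemmas C_k_mult = C_k_scaleR[where 'b = real, simplified]

lemma C_k_affine: "C_k k S (\<lambda>x. c * x + d :: real)"
proof (cases k)
  case (Suc m)
  have "((\<lambda>x. c * x + d) has_derivative (\<lambda>v. c * v)) (at x)" for x
    by (auto intro!: derivative_eq_intros)
  then show ?thesis unfolding Suc C_k.simps
    by (intro exI[of _ "\<lambda>x v. c * v"]) (auto intro: C_k_const)
qed (auto intro!: continuous_intros)

text \<open>As \<open>f\<close> is real-valued, linearity turns the chain rule into a scalar
  product: the derivative in direction \<open>v\<close> is \<open>f' x v\<close> times the vector
  \<open>g' (f x) 1\<close>. The induction therefore needs no product other than
  \<open>C_k_scaleR\<close>.\<close>

lemma C_k_compose: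
  fixes f :: "'a::euclidean_space \<Rightarrow> real"
  assumes "C_k k S f" "C_k k T g" "f ` S \<subseteq> T"
  shows "C_k k S (\<lambda>x. g (f x))"
  using assms
proof (induction k arbitrary: f g)
  case 0
  then show ?case by (auto intro: continuous_on_compose2)
next
  case (Suc k)
  obtain f' where f': "\<And>x. x \<in> S \<Longrightarrow> (f has_derivative f' x) (at x)" "\<And>v. C_k k S (\<lambda>x. f' x v)"
    using C_k_SucE[OF Suc.prems(1)] by blast
  obtain g' where g': "\<And>x. x \<in> T \<Longrightarrow> (g has_derivative g' x) (at x)" "\<And>v. C_k k T (\<lambda>x. g' x v)"
    using C_k_SucE[OF Suc.prems(2)] by blast
  note d = f'(1) g'(1) and c = f'(2) g'(2)
  have "((\<lambda>x. g (f x)) has_derivative (\<lambda>v. f' x v *\<^sub>R g' (f x) 1)) (at x)" if "x \<in> S" for x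
  proof -
    have fx: "f x \<in> T" using that Suc.prems by auto
    have "((\<lambda>x. g (f x)) has_derivative (\<lambda>v. g' (f x) (f' x v))) (at x)"
      using diff_chain_at[OF d(1)[OF that] d(2)[OF fx]] by (simp add: o_def)
    moreover have "g' (f x) (f' x v) = f' x v *\<^sub>R g' (f x) 1" for v
      using linear_cmul[OF has_derivative_linear[OF d(2)[OF fx]], of "f' x v" 1] by simp
    ultimately show ?thesis by simp
  qed
  moreover have "C_k k S (\<lambda>x. f' x v *\<^sub>R g' (f x) 1)" for v
    by (rule C_k_scaleR[OF c(1) Suc.IH[OF C_k_lower[OF Suc.prems(1)] c(2) Suc.prems(3)]])
  ultimately show ?case unfolding C_k.simps
    by (intro exI[of _ "\<lambda>x v. f' x v *\<^sub>R g' (f x) 1"]) simp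
qed

text \<open>The derivative is a product of copies of \<open>inverse\<close> itself, so each order of
  differentiability yields the next.\<close>

lemma C_k_inverse: "C_k k {0<..} (inverse :: real \<Rightarrow> real)"
proof (induction k)
  case 0
  then show ?case by (auto intro!: continuous_intros)
next
  case (Suc k)
  have "(inverse has_derivative (\<lambda>v. - v * (inverse x * inverse x))) (at x)"
    if "x \<in> {0<..}" for x :: real
    using that by (auto intro!: derivative_eq_intros simp: algebra_simps)
  moreover have "C_k k {0<..} (\<lambda>x :: real. - v * (inverse x * inverse x))" for v
    by (rule C_k_mult[OF C_k_const C_k_mult[OF Suc Suc]])
  ultimately show ?case
    by (auto intro!: exI[of _ "\<lambda>x v. - v * (inverse x * inverse x)"] simp del: mult_minus_left)
qed

section \<open>Smoothness of the step function\<close>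

text \<open>The function \<open>h\<close> inside \<open>smooth_step\<close> is
  \<open>flat 0\<close>. The powers in the denominator are included because the derivative of each
  \<open>flat n\<close> is a linear combination of members of the same family, so all orders of
  differentiability follow by one induction.\<close>

definition flat :: "nat \<Rightarrow> real \<Rightarrow> real" where
  "flat n r = (if r \<le> 0 then 0 else exp (- 1 / r) / r ^ n)"

lemma flat_deriv:
  "(flat n has_real_derivative (flat (n + 2) x - n * flat (n + 1) x)) (at x)"
proof -
  consider "x < 0" | "x = 0" | "x > 0" by linarith
  then show ?thesis
  proof cases
    case 1
    have "((\<lambda>_. 0) has_real_derivative (flat (n + 2) x - n * flat (n + 1) x)) (at x)"
      using 1 by (simp add: flat_def)
    then show ?thesis
      by (rule has_field_derivative_transform_within_open[of _ _ _ "{..<0}"])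
        (use 1 in \<open>auto simp: flat_def\<close>)
  next
    case 2
    \<comment> \<open>The right-hand difference quotient at 0 becomes
      \<open>u ^ Suc n / exp u\<close> under \<open>u = 1 / h\<close>, and the exponential dominates
      every power as \<open>u\<close> tends to infinity.\<close>
    have "((\<lambda>h. exp (- 1 / h) / h ^ n / h) \<longlongrightarrow> 0) (at_right (0::real))"
    proof -
      have "((\<lambda>u::real. u ^ Suc n / exp u) \<longlongrightarrow> 0) at_top" by (rule tendsto_power_div_exp_0)
      then have "((\<lambda>h::real. inverse h ^ Suc n / exp (inverse h)) \<longlongrightarrow> 0) (at_right 0)"
        by (rule filterlim_compose[OF _ filterlim_inverse_at_top_right])
      then show ?thesis
        by (rule Lim_transform_eventually)
          (auto intro!: always_eventually simp: field_simps exp_minus)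
    qed
    then have "((\<lambda>h. flat n h / h) \<longlongrightarrow> 0) (at_right 0)"
      by (rule Lim_transform_eventually)
        (auto simp: flat_def eventually_at_right_field intro: exI[of _ 1])
    moreover have "((\<lambda>h. flat n h / h) \<longlongrightarrow> 0) (at_left 0)"
      by (rule Lim_transform_eventually[OF tendsto_const])
        (auto simp: flat_def eventually_at_left_field intro: exI[of _ "-1"])
    ultimately have "((\<lambda>h. flat n h / h) \<longlongrightarrow> 0) (at 0)"
      by (simp add: filterlim_split_at)
    with 2 show ?thesis
      by (simp add: DERIV_def flat_def)
  next
    case 3
    have "((\<lambda>r. exp (- 1 / r) / r ^ n) has_real_derivative
        (flat (n + 2) x - n * flat (n + 1) x)) (at x)"
      using 3
      by (auto intro!: derivative_eq_intros simp: flat_def divide_simps power2_eq_square,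
          cases n, auto simp: algebra_simps)
    then show ?thesis
      by (rule has_field_derivative_transform_within_open[of _ _ _ "{0<..}"])
        (use 3 in \<open>auto simp: flat_def\<close>)
  qed
qed

lemma C_k_flat: "C_k k UNIV (flat n)"
proof (induction k arbitrary: n)
  case 0
  have "isCont (flat n) x" for x using flat_deriv DERIV_isCont by blast
  then show ?case by (simp add: continuous_at_imp_continuous_on)
next
  case (Suc k)
  have "(flat n has_derivative (\<lambda>v. v * (flat (n + 2) x + - real n * flat (n + 1) x))) (at x)" for x
    by (rule has_derivative_eq_rhs[OF flat_deriv[unfolded has_field_derivative_def]])
      (simp add: fun_eq_iff algebra_simps)
  moreover have "C_k k UNIV (\<lambda>x. v * (flat (n + 2) x + - real n * flat (n + 1) x))" for v
    by (rule C_k_mult[OF C_k_const C_k_add[OF Suc C_k_mult[OF C_k_const Suc]]])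
  ultimately show ?case unfolding C_k.simps
    by (intro exI[of _ "\<lambda>x v. v * (flat (n + 2) x + - real n * flat (n + 1) x)"]) simp
qed

lemma flat_less: "0 \<le> r \<Longrightarrow> r < s \<Longrightarrow> flat 0 r < flat 0 s"
  by (auto simp: flat_def field_simps)

lemma flat_nonneg: "0 \<le> flat 0 r"
  by (simp add: flat_def)

lemma flat_sum_pos: "0 < flat 0 s + flat 0 (1 - s)"
  by (cases "s \<le> 0"; cases "1 - s \<le> 0") (auto simp: flat_def add_pos_pos)

lemma smooth_step_flat: "smooth_step s = flat 0 s * inverse (flat 0 s + flat 0 (1 - s))"
  by (simp add: smooth_step_def flat_def Let_def divide_inverse)

lemma C_k_smooth_step: "C_k k UNIV smooth_step"
proof -
  have "C_k k UNIV (\<lambda>s. flat 0 (- 1 * s + 1))"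
    by (rule C_k_compose[OF C_k_affine C_k_flat]) simp
  then have "C_k k UNIV (\<lambda>s. flat 0 s + flat 0 (1 - s))"
    by (intro C_k_add C_k_flat) simp
  then have "C_k k UNIV (\<lambda>s. inverse (flat 0 s + flat 0 (1 - s)))"
    by (rule C_k_compose[OF _ C_k_inverse]) (auto intro: flat_sum_pos)
  then have "C_k k UNIV (\<lambda>s. flat 0 s * inverse (flat 0 s + flat 0 (1 - s)))"
    by (rule C_k_mult[OF C_k_flat])
  then show ?thesis by (simp add: smooth_step_flat[abs_def])
qed

lemma smooth_step_le_0: "s \<le> 0 \<Longrightarrow> smooth_step s = 0"
  by (simp add: smooth_step_flat flat_def)

lemma smooth_step_ge_1: "1 \<le> s \<Longrightarrow> smooth_step s = 1"
  by (simp add: smooth_step_flat flat_def)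

lemma smooth_step_less:
  assumes "0 \<le> r" "r < s" "s \<le> 1"
  shows "smooth_step r < smooth_step s"
proof -
  let ?f = "flat 0"
  have *: "?f r < ?f s" "?f (1 - s) < ?f (1 - r)" using assms by (auto intro!: flat_less)
  \<comment> \<open>After clearing the positive denominators the term \<open>?f r * ?f s\<close>
    cancels, leaving a comparison of cross products. The first inequality is weak because
    \<open>?f r\<close> vanishes at \<open>r = 0\<close>; the strictness comes from the second,
    where \<open>?f (1 - r)\<close> is positive.\<close>
  have "?f r * ?f (1 - s) \<le> ?f r * ?f (1 - r)" using * flat_nonneg by (intro mult_left_mono) auto
  also have "\<dots> < ?f s * ?f (1 - r)"
    using * flat_nonneg[of "1 - s"] by (intro mult_strict_right_mono) auto
  finally have "?f r * (?f s + ?f (1 - s)) < ?f s * (?f r + ?f (1 - r))"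
    by (simp add: algebra_simps)
  then show ?thesis
    unfolding smooth_step_flat divide_inverse[symmetric]
    by (simp add: divide_less_eq less_divide_eq flat_sum_pos)
qed

lemma smooth_step_range: "0 \<le> s \<Longrightarrow> s < 1 \<Longrightarrow> 0 \<le> smooth_step s \<and> smooth_step s < 1"
  using smooth_step_less[of s 1] smooth_step_less[of 0 s] smooth_step_le_0[of 0] smooth_step_ge_1[of 1]
  by (cases "s = 0") auto

section \<open>Loops along arcs of the circle\<close>

lemma cis_Arg2pi: "z \<in> circle \<Longrightarrow> cis (Arg2pi z) = z"
  by (simp add: cis_conv_exp complex_norm_eq_1_exp)

lemma Arg2pi_cis: "0 \<le> t \<Longrightarrow> t < 2 * pi \<Longrightarrow> Arg2pi (cis t) = t"
  by (rule Arg2pi_unique[of 1]) (simp_all add: cis_conv_exp)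

lemma cis_inj: "\<lbrakk>cis s = cis t; 0 \<le> s; s < 2 * pi; 0 \<le> t; t < 2 * pi\<rbrakk> \<Longrightarrow> s = t"
  by (metis Arg2pi_cis)

lemma circle_mult_cis_Arg2pi: "\<lbrakk>x \<in> circle; y \<in> circle\<rbrakk> \<Longrightarrow> x * cis (Arg2pi (y / x)) = y"
  by (subst cis_Arg2pi) (auto simp: norm_divide)

text \<open>The quotients \<open>y / x\<close> and \<open>x / y\<close> are inverse unit numbers, so
  the angles of the two complementary arcs add up to a full turn; distinctness of the points
  excludes the angle 0.\<close>

lemma Arg2pi_quotient:
  assumes "x \<in> circle" "y \<in> circle" "x \<noteq> y"
  shows "0 < Arg2pi (y / x)" "Arg2pi (y / x) < 2 * pi" "Arg2pi (x / y) = 2 * pi - Arg2pi (y / x)"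
proof -
  let ?a = "Arg2pi (y / x)"
  have "?a \<noteq> 0" using circle_mult_cis_Arg2pi[OF assms(1,2)] assms(3) by auto
  then show a: "0 < ?a" "?a < 2 * pi" using Arg2pi[of "y / x"] by auto
  have "x / y = cis (- ?a)"
    using assms by (simp add: cis_inverse[symmetric] cis_Arg2pi norm_divide)
  also have "\<dots> = cis (2 * pi - ?a)" by (simp add: cis.ctr)
  finally show "Arg2pi (x / y) = 2 * pi - ?a" using Arg2pi_cis a by simp
qed

lemma arc_point_circle: "x \<in> circle \<Longrightarrow> arc_point x y z \<in> circle"
  by (simp add: arc_point_def norm_mult)

lemma arc_point_1: "arc_point x y 1 = x"
proof -
  have "Arg2pi 1 = 0" using Arg2pi_cis[of 0] by simp
  then show ?thesis by (simp add: arc_point_def smooth_step_le_0)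
qed

lemma smooth_step_Arg2pi: "0 \<le> smooth_step (Arg2pi z / (2 * pi))" "smooth_step (Arg2pi z / (2 * pi)) < 1"
  using Arg2pi[of z] smooth_step_range[of "Arg2pi z / (2 * pi)"] by (auto simp: divide_less_eq)

text \<open>Since \<open>Arg2pi\<close> never reaches \<open>2 * pi\<close>, the step function stays
  below 1 and the arc is traversed without its end \<open>y\<close>. The angles stay in an interval
  shorter than a full turn, where \<open>cis\<close> is injective, and the step function is strictly
  increasing.\<close>

lemma inj_on_arc_point:
  assumes "x \<in> circle" "y \<in> circle" "x \<noteq> y"
  shows "inj_on (arc_point x y) circle"
proof (rule inj_onI)
  fix z w assume zw: "z \<in> circle" "w \<in> circle" "arc_point x y z = arc_point x y w"
  let ?a = "Arg2pi (y / x)" and ?s = "\<lambda>z. smooth_step (Arg2pi z / (2 * pi))"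
  have r: "0 \<le> ?a * ?s z" "?a * ?s z < 2 * pi" for z
  proof -
    note a = Arg2pi_quotient(1,2)[OF assms] and s = smooth_step_Arg2pi[of z]
    show "0 \<le> ?a * ?s z" using a s by simp
    have "?a * ?s z < ?a * 1" using a s by (intro mult_strict_left_mono)
    then show "?a * ?s z < 2 * pi" using a(2) by (simp only: mult_1_right)
  qed
  have "cis (?a * ?s z) = cis (?a * ?s w)"
    using zw(3) assms(1) by (auto simp: arc_point_def)
  then have "?s z = ?s w" using cis_inj r Arg2pi_quotient(1)[OF assms] by fastforce
  then have "Arg2pi z / (2 * pi) = Arg2pi w / (2 * pi)"
    using smooth_step_less[of "Arg2pi z / (2 * pi)" "Arg2pi w / (2 * pi)"]
      smooth_step_less[of "Arg2pi w / (2 * pi)" "Arg2pi z / (2 * pi)"] Arg2pi[of z] Arg2pi[of w]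
    by (cases "Arg2pi z" "Arg2pi w" rule: linorder_cases) (auto simp: divide_less_eq divide_strict_right_mono)
  then show "z = w" using cis_Arg2pi zw by (metis divide_cancel_right pi_neq_zero mult_eq_0_iff zero_neq_numeral)
qed

text \<open>Measured from \<open>x\<close>, with \<open>a\<close> the angle of \<open>y\<close>, the
  first arc uses angles in \<open>[0, a)\<close> and the second angles in
  \<open>[a, 2 * pi)\<close>. Each half-open arc omits its own end.\<close>

lemma arc_point_disjoint:
  assumes "x \<in> circle" "y \<in> circle" "x \<noteq> y"
  shows "arc_point x y z \<noteq> arc_point y x w"
proof
  assume eq: "arc_point x y z = arc_point y x w"
  let ?a = "Arg2pi (y / x)" and ?s = "smooth_step (Arg2pi z / (2 * pi))"
    and ?t = "smooth_step (Arg2pi w / (2 * pi))"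
  note a = Arg2pi_quotient[OF assms]
  have s: "0 \<le> ?a * ?s" "?a * ?s < ?a"
    using a smooth_step_Arg2pi[of z] mult_strict_left_mono[of ?s 1 ?a] by auto
  have t: "0 \<le> (2 * pi - ?a) * ?t" "(2 * pi - ?a) * ?t < 2 * pi - ?a"
    using a smooth_step_Arg2pi[of w] mult_strict_left_mono[of ?t 1 "2 * pi - ?a"] by auto
  have "x * cis (?a * ?s) = (x * cis ?a) * cis ((2 * pi - ?a) * ?t)"
    using eq circle_mult_cis_Arg2pi[OF assms(1,2)] a(3) by (simp add: arc_point_def)
  then have "cis (?a * ?s) = cis (?a + (2 * pi - ?a) * ?t)"
    using assms(1) by (auto simp: cis_mult mult.assoc)
  with s t a show False using cis_inj[of "?a * ?s" "?a + (2 * pi - ?a) * ?t"] by linarith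
qed

section \<open>Continuity and smoothness of loops along arcs\<close>

lemma cis_diff_2pi: "cis (t - 2 * pi * of_int m) = cis t"
  by (simp add: cis_divide[symmetric] cis_multiple_2pi)

text \<open>\<open>Arg2pi\<close> jumps at multiples of \<open>2 * pi\<close>, so the
  parametrisation is described on one period at a time. At the right end \<open>cis t\<close> is 1
  and \<open>arc_point\<close> has returned to \<open>x\<close>, while the formula on the right
  gives \<open>y\<close>; the hypothesis \<open>b x = b y\<close> reconciles the two.\<close>

lemma arc_point_cis:
  assumes "x \<in> circle" "y \<in> circle" "b x = b y"
    and t: "2 * pi * of_int m \<le> t" "t \<le> 2 * pi * of_int (m + 1)"
  shows "b (arc_point x y (cis t)) = b (x * cis (Arg2pi (y / x) * smooth_step (t / (2 * pi) - of_int m)))"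
proof (cases "t = 2 * pi * of_int (m + 1)")
  case True
  then have "cis t = 1" using cis_diff_2pi[of t "m + 1"] by simp
  with True assms(3) circle_mult_cis_Arg2pi[OF assms(1,2)] show ?thesis
    by (simp add: arc_point_1 smooth_step_ge_1)
next
  case False
  then have "Arg2pi (cis t) = t - 2 * pi * of_int m"
    using t Arg2pi_cis[of "t - 2 * pi * of_int m"] unfolding cis_diff_2pi
    by (simp add: algebra_simps)
  then show ?thesis by (simp add: arc_point_def diff_divide_distrib)
qed

lemma continuous_smooth_step: "continuous_on S smooth_step"
  using C_k_smooth_step[of 0] continuous_on_subset by auto

text \<open>Through \<open>cis\<close> the circle is a quotient of a closed interval, so continuity
  may be tested on that interval, where the angle is given by a single continuous formula.\<close>

lemma continuous_map_arc:
  assumes "continuous_map (top_of_set circle) F b" "x \<in> circle" "y \<in> circle" "b x = b y"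
  shows "continuous_map (top_of_set circle) F (\<lambda>z. b (arc_point x y z))"
proof -
  let ?I = "{0..2 * pi}"
  have "quotient_map (top_of_set ?I) (top_of_set circle) cis"
  proof (rule continuous_imp_quotient_map)
    show "continuous_map (top_of_set ?I) (top_of_set circle) cis"
      by (auto intro!: continuous_intros)
    have "z \<in> cis ` ?I" if "z \<in> circle" for z
      using cis_Arg2pi[OF that] Arg2pi[of z] by (metis atLeastAtMost_iff image_eqI less_imp_le)
    then show "cis ` topspace (top_of_set ?I) = topspace (top_of_set circle)" by auto
  qed (auto simp: compact_space_subtopology Hausdorff_space_subtopology)
  moreover have "continuous_map (top_of_set ?I) F ((\<lambda>z. b (arc_point x y z)) \<circ> cis)"
  proof (rule continuous_map_eq)
    let ?p = "\<lambda>t. x * cis (Arg2pi (y / x) * smooth_step (t / (2 * pi)))"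
    have "continuous_map (top_of_set ?I) (top_of_set circle) ?p"
      using assms(2)
      by (auto simp: norm_mult intro!: continuous_intros continuous_on_compose2[OF continuous_smooth_step[of UNIV]])
    then show "continuous_map (top_of_set ?I) F (b \<circ> ?p)"
      using assms(1) by (rule continuous_map_compose)
    show "(b \<circ> ?p) t = ((\<lambda>z. b (arc_point x y z)) \<circ> cis) t" if "t \<in> topspace (top_of_set ?I)" for t
      using arc_point_cis[OF assms(2-4), of 0 t] that by simp
  qed
  ultimately show ?thesis
    using continuous_compose_quotient_map by blast
qed

text \<open>Smoothness is checked near each parameter. Inside a period the loop is \<open>b\<close>
  read along a smooth angle function; at a multiple of \<open>2 * pi\<close> the angle functions of
  the two neighbouring periods are glued, both being flat there.\<close>

lemma smooth_loop_arc:
  assumes A: "\<forall>(U, \<psi>)\<in>A. openin F U" and b: "smooth_loop F A b"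
    and xy: "x \<in> circle" "y \<in> circle" "b x = b y"
  shows "smooth_loop F A (\<lambda>z. b (arc_point x y z))"
proof -
  let ?a = "\<lambda>t. b (arc_point x y (cis t))"
  have cb: "continuous_map (top_of_set circle) F b" using b by (simp add: smooth_loop_def)
  have "C_k k {t. ?a t \<in> U} (\<lambda>t. \<psi> (?a t))" if U: "(U, \<psi>) \<in> A" for U \<psi> k
  proof (rule C_k_local)
    fix t\<^sub>0 assume "t\<^sub>0 \<in> {t. ?a t \<in> U}"
    then have t\<^sub>0: "?a t\<^sub>0 \<in> U" by simp
    define W where "W = {s. b (cis s) \<in> U}"
    define G where "G = (\<lambda>s. \<psi> (b (cis s)))"
    have G: "C_k k W G" using b U by (auto simp: smooth_loop_def smooth_on_def W_def G_def)
    have "continuous_map euclideanreal F (b \<circ> cis)"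
      by (rule continuous_map_compose[OF _ cb])
        (auto simp: continuous_map_in_subtopology continuous_map_iff_continuous2 intro!: continuous_intros)
    moreover have "openin F U" using A U by auto
    ultimately have W: "open W"
      unfolding W_def using openin_continuous_map_preimage by fastforce
    \<comment> \<open>\<open>\<phi> m\<close> is the angle of the loop on the period with index
      \<open>m\<close>, continued to all real \<open>t\<close>: before the period it rests at the
      angle of \<open>x\<close>, afterwards at an angle of \<open>y\<close>.\<close>
    define \<phi> where "\<phi> m t = Arg2pi x + Arg2pi (y / x) * smooth_step (t / (2 * pi) - real_of_int m)" for m t
    have \<phi>: "C_k k UNIV (\<phi> m)" for m k
    proof -
      have "C_k k UNIV (\<lambda>t. smooth_step (1 / (2 * pi) * t + - real_of_int m))"
        by (rule C_k_compose[OF C_k_affine C_k_smooth_step]) simp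
      then have "C_k k UNIV (\<lambda>t. Arg2pi x + Arg2pi (y / x) * smooth_step (1 / (2 * pi) * t + - real_of_int m))"
        by (intro C_k_add[OF C_k_const C_k_mult[OF C_k_const]])
      then show ?thesis by (simp add: \<phi>_def[abs_def])
    qed
    define T where "T m = {t. \<phi> m t \<in> W}" for m
    have T: "open (T m)" for m
      using open_vimage[OF W, of "\<phi> m"] \<phi>[of 0 m] by (simp add: T_def vimage_def)
    have G\<phi>: "C_k k (T m) (\<lambda>t. G (\<phi> m t))" for m
      by (rule C_k_compose[OF C_k_subset[OF \<phi>] G]) (auto simp: T_def)
    have a: "?a t = b (cis (\<phi> m t))"
      if "2 * pi * of_int m \<le> t" "t \<le> 2 * pi * of_int (m + 1)" for m t
      using arc_point_cis[of x y b, OF xy that] cis_Arg2pi[OF xy(1)]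
      by (simp add: \<phi>_def cis_mult[symmetric])
    show "\<exists>T. open T \<and> t\<^sub>0 \<in> T \<and> C_k k T (\<lambda>t. \<psi> (?a t))"
    proof (cases "t\<^sub>0 / (2 * pi) \<in> \<int>")
      case False
      define m where "m = \<lfloor>t\<^sub>0 / (2 * pi)\<rfloor>"
      have "of_int m \<noteq> t\<^sub>0 / (2 * pi)" using False by (metis Ints_of_int)
      then have "of_int m < t\<^sub>0 / (2 * pi)" "t\<^sub>0 / (2 * pi) < of_int (m + 1)"
        unfolding m_def by linarith+
      then have m: "2 * pi * of_int m < t\<^sub>0" "t\<^sub>0 < 2 * pi * of_int (m + 1)"
        by (simp_all add: field_simps)
      let ?T = "T m \<inter> {2 * pi * of_int m<..<2 * pi * of_int (m + 1)}"
      have "open ?T" using T by auto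
      moreover have "t\<^sub>0 \<in> ?T" using m t\<^sub>0 a[of m t\<^sub>0] by (simp add: T_def W_def)
      moreover have "C_k k ?T (\<lambda>t. \<psi> (?a t))"
        by (rule C_k_cong[OF \<open>open ?T\<close> _ C_k_subset[OF G\<phi>[of m]]])
          (use a[of m] in \<open>auto simp: G_def\<close>)
      ultimately show ?thesis by blast
    next
      case True
      then obtain m where "t\<^sub>0 / (2 * pi) = of_int m" by (auto elim: Ints_cases)
      then have m: "t\<^sub>0 = 2 * pi * of_int m" by (simp add: field_simps)
      have \<phi>0: "b (cis (\<phi> m t)) = b x" if "t \<le> t\<^sub>0" for t
        using that cis_Arg2pi[OF xy(1)] by (simp add: \<phi>_def m smooth_step_le_0 field_simps)
      have \<phi>1: "b (cis (\<phi> (m - 1) t)) = b x" if "t \<ge> t\<^sub>0" for t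
        using that cis_Arg2pi[OF xy(1)] circle_mult_cis_Arg2pi[OF xy(1,2)] xy(3)
        by (simp add: \<phi>_def m smooth_step_ge_1 field_simps cis_mult[symmetric])
      \<comment> \<open>On each side of \<open>t\<^sub>0\<close> one of the two summands is constant, because the step function is
        constant outside the unit interval.\<close>
      let ?T = "T m \<inter> T (m - 1) \<inter> {2 * pi * of_int (m - 1)<..<2 * pi * of_int (m + 1)}"
      have "open ?T" by (intro open_Int T open_greaterThanLessThan)
      moreover have "b x \<in> U" using t\<^sub>0 a[of m t\<^sub>0] \<phi>0[of t\<^sub>0] m by (simp add: field_simps)
      then have "t\<^sub>0 \<in> ?T" using m \<phi>0[of t\<^sub>0] \<phi>1[of t\<^sub>0] by (simp add: T_def W_def field_simps)
      moreover have "C_k k ?T (\<lambda>t. \<psi> (?a t))"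
      proof (rule C_k_cong[OF \<open>open ?T\<close>])
        show "C_k k ?T (\<lambda>t. G (\<phi> m t) + G (\<phi> (m - 1) t) + - \<psi> (b x))"
          by (intro C_k_add C_k_const C_k_subset[OF G\<phi>]) auto
        fix t assume t: "t \<in> ?T"
        show "G (\<phi> m t) + G (\<phi> (m - 1) t) + - \<psi> (b x) = \<psi> (?a t)"
        proof (cases "t \<le> t\<^sub>0")
          case True
          with t show ?thesis using a[of "m - 1" t] \<phi>0[of t] m by (simp add: G_def)
        next
          case False
          with t show ?thesis using a[of m t] \<phi>1[of t] m by (simp add: G_def)
        qed
      qed
      ultimately show ?thesis by blast
    qed
  qed
  with continuous_map_arc[of F b, OF cb xy] show ?thesis
    by (auto simp: smooth_loop_def smooth_on_def)
qed

section \<open>Split diagrams\<close>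

lemma smooth_loop_cong:
  assumes "\<And>z. z \<in> circle \<Longrightarrow> a z = b z" "smooth_loop F A a"
  shows "smooth_loop F A b"
proof -
  have "a (cis t) = b (cis t)" for t using assms(1) by simp
  moreover have "continuous_map (top_of_set circle) F b"
    using assms by (auto simp: smooth_loop_def intro: continuous_map_eq)
  ultimately show ?thesis using assms(2) by (simp add: smooth_loop_def)
qed

text \<open>A homotopy prescribes its final map only on the core circles, so properties of its last
  stage have to be carried over to a map that may differ elsewhere.\<close>

lemma geometrical_cong:
  assumes "geometrical F A D" "ncirc D' = ncirc D" "chords D' = chords D"
    and eq: "\<And>u. u \<in> points (ncirc D) \<Longrightarrow> cmap D u = cmap D' u"
  shows "geometrical F A D'"
proof -
  have loop: "smooth_loop F A (\<lambda>z. cmap D' (j, z))" if "j \<in> {1..ncirc D}" for j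
  proof (rule smooth_loop_cong)
    show "smooth_loop F A (\<lambda>z. cmap D (j, z))" using assms(1) that by (simp add: geometrical_def)
    show "cmap D (j, z) = cmap D' (j, z)" if "z \<in> circle" for z
      using eq[of "(j, z)"] that \<open>j \<in> {1..ncirc D}\<close> by (simp add: points_def)
  qed
  have const: "cmap D' u = cmap D' v" if c: "c \<in> chords D" "u \<in> c" "v \<in> c" for c u v
  proof -
    have sub: "c \<subseteq> points (ncirc D)" and "cmap D u = cmap D v"
      using assms(1) c unfolding geometrical_def chord_system_def by blast+
    with eq[OF subsetD[OF sub c(2)]] eq[OF subsetD[OF sub c(3)]] show ?thesis by simp
  qed
  show ?thesis
    unfolding geometrical_def assms(2,3)
  proof (intro conjI ballI)
    show "chord_system (ncirc D) (chords D)" using assms(1) by (simp add: geometrical_def)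
  qed (rule loop const; assumption)+
qed

text \<open>An endpoint moves continuously while labels are discrete, so by connectedness of the
  time interval it stays on its circle and chords remain external. This lets \<open>mu_class\<close>
  work with a representative other than the given one.\<close>

lemma homotopic_ext_geometrical:
  assumes "homotopic_diagrams F A D D'" "ext_geometrical F A D"
  shows "ext_geometrical F A D'"
proof -
  obtain H e where n: "ncirc D' = ncirc D"
    and st: "\<forall>t\<in>{0..1::real}. inj_on (e t) (\<Union>(chords D)) \<and>
       geometrical F A \<lparr>ncirc = ncirc D, chords = (`) (e t) ` chords D, cmap = H t\<rparr>"
    and ct: "\<forall>u\<in>\<Union>(chords D). continuous_on {0..1::real} (\<lambda>t. e t u)"
    and e0: "\<forall>u\<in>\<Union>(chords D). e 0 u = u"
    and e1: "(`) (e 1) ` chords D = chords D'"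
    and H1: "\<forall>u\<in>points (ncirc D). H 1 u = cmap D' u"
    using assms(1) unfolding homotopic_diagrams_def by (elim conjE exE) (rule that; assumption)
  have stage: "geometrical F A \<lparr>ncirc = ncirc D, chords = (`) (e 1) ` chords D, cmap = H 1\<rparr>"
    by (rule conjunct2[OF bspec[OF st]]) simp
  have "geometrical F A D'"
    by (rule geometrical_cong[OF stage]) (simp_all add: n e1 H1)
  moreover have "fst (e 1 u) = fst u" if "u \<in> \<Union>(chords D)" for u
  proof -
    have "continuous_on {0..1} (\<lambda>t. fst (e t u))"
      by (intro continuous_on_fst bspec[OF ct] that)
    then have "connected ((\<lambda>t. fst (e t u)) ` {0..1::real})"
      by (intro connected_continuous_image) auto
    from connectedD[OF this, of "{fst u}" "- {fst u}"]
    have "{fst u} \<inter> (\<lambda>t. fst (e t u)) ` {0..1} = {} \<or> - {fst u} \<inter> (\<lambda>t. fst (e t u)) ` {0..1} = {}"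
      by (auto simp: open_discrete)
    moreover have "fst u \<in> (\<lambda>t. fst (e t u)) ` {0..1::real}"
      by (rule image_eqI[of _ _ 0]) (simp_all add: bspec[OF e0 that])
    moreover have "fst (e 1 u) \<in> (\<lambda>t. fst (e t u)) ` {0..1::real}" by auto
    ultimately show ?thesis by blast
  qed
  note fst_e1 = this
  have "external c" if "c \<in> chords D'" for c
  proof -
    from that obtain d where d: "d \<in> chords D" "c = e 1 ` d" unfolding e1[symmetric] by blast
    have "inj_on fst d" using d(1) assms(2) by (simp add: ext_geometrical_def external_def)
    moreover have "fst (e 1 u) = fst u" if "u \<in> d" for u using fst_e1 d(1) that by blast
    ultimately have "inj_on (fst \<circ> e 1) d" by (simp cong: inj_on_cong)
    then show ?thesis unfolding external_def d(2) by (rule inj_on_imageI)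
  qed
  ultimately show ?thesis by (simp add: ext_geometrical_def)
qed

section \<open>Geometricity of split diagrams\<close>

lemma unsplit_point_simps:
  "unsplit_point i x y (i, z) = (i, arc_point x y z)"
  "unsplit_point i x y (Suc i, z) = (i, arc_point y x z)"
  by (simp_all add: unsplit_point_def)

lemma fst_unsplit_point: "fst (unsplit_point i x y u) = (if fst u \<le> i then fst u else fst u - 1)"
  by (cases u) (auto simp: unsplit_point_def)

text \<open>The circles \<open>i\<close> and \<open>i + 1\<close> are carried injectively to
  disjoint half-open arcs of the old circle \<open>i\<close>; all other circles are merely
  renumbered.\<close>

lemma inj_on_unsplit_point:
  assumes "x \<in> circle" "y \<in> circle" "x \<noteq> y"
  shows "inj_on (unsplit_point i x y) (points n)"
proof (rule inj_onI)
  fix u v assume uv: "u \<in> points n" "v \<in> points n" "unsplit_point i x y u = unsplit_point i x y v"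
  obtain j z k w where u: "u = (j, z)" "v = (k, w)" by fastforce
  then have zw: "z \<in> circle" "w \<in> circle" using uv by (auto simp: points_def)
  have "z = w" if "arc_point x y z = arc_point x y w"
    using inj_onD[OF inj_on_arc_point[OF assms] that zw] .
  moreover have "z = w" if "arc_point y x z = arc_point y x w"
    using inj_onD[OF inj_on_arc_point[OF assms(2,1) assms(3)[symmetric]] that zw] .
  moreover note arc_point_disjoint[OF assms] arc_point_disjoint[OF assms, THEN not_sym]
  ultimately show "u = v"
    using uv(3) u by (auto simp: unsplit_point_def split: if_splits)
qed

text \<open>Injectivity of \<open>unsplit_point\<close> transfers finiteness and disjointness from
  the old chords, \<open>smooth_loop_arc\<close> supplies the two new loops, and the absence of
  triple points keeps the old chords away from the added one.\<close>

lemma ext_geometrical_split_diagram: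
  assumes A: "\<forall>(U, \<psi>)\<in>A. openin F U" and D: "ext_geometrical F A D" and gp: "general_position A D"
    and i: "i \<in> {1..ncirc D}"
    and xy: "x \<in> circle" "y \<in> circle" "x \<noteq> y" "cmap D (i, x) = cmap D (i, y)"
  shows "ext_geometrical F A (split_diagram D i x y)"
proof -
  let ?n = "ncirc D" and ?g = "unsplit_point i x y"
  let ?d = "{(i, 1), (i + 1, 1)}"
  let ?L = "{c. c \<subseteq> points (?n + 1) \<and> card c = 2 \<and> ?g ` c \<in> chords D}"
  have geo: "geometrical F A D" and ext: "\<And>c. c \<in> chords D \<Longrightarrow> external c"
    using D by (simp_all add: ext_geometrical_def)
  then have C: "finite (chords D)" "\<And>c. c \<in> chords D \<Longrightarrow> c \<subseteq> points ?n" "pairwise disjnt (chords D)"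
    and loops: "\<And>j. j \<in> {1..?n} \<Longrightarrow> smooth_loop F A (\<lambda>z. cmap D (j, z))"
    by (simp_all add: geometrical_def chord_system_def)
  have const: "cmap D u = cmap D v" if "c \<in> chords D" "u \<in> c" "v \<in> c" for c u v
    using geo that unfolding geometrical_def by blast
  note inj = inj_on_unsplit_point[OF xy(1-3), of i "?n + 1"]
  have base: "?g (i, 1) = (i, x)" "?g (i + 1, 1) = (i, y)"
    by (simp_all add: unsplit_point_simps arc_point_1)
  have base_in: "?d \<subseteq> points (?n + 1)" using i by (auto simp: points_def)
  have not_base: "?g u \<noteq> (i, x) \<and> ?g u \<noteq> (i, y)" if c: "c \<in> ?L" "u \<in> c" for c u
  proof -
    \<comment> \<open>Otherwise the other endpoint of the chord would make this a triple point.\<close>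
    have "\<exists>v. v \<in> c \<and> v \<noteq> u"
    proof (rule ccontr)
      assume "\<not> ?thesis"
      with c(2) have "c = {u}" by auto
      with c(1) show False by simp
    qed
    then obtain v where v: "v \<in> c" "v \<noteq> u" by blast
    have gc: "?g ` c \<in> chords D" "c \<subseteq> points (?n + 1)" using c by auto
    have ne: "?g u \<noteq> ?g v" using inj_onD[OF inj _ _, of u v] v c gc by auto
    \<comment> \<open>The old chord is external, so if \<open>?g u\<close> lay on circle
      \<open>i\<close>, the point \<open>?g v\<close> would lie on another circle and be distinct
      from both \<open>(i, x)\<close> and \<open>(i, y)\<close>.\<close>
    then have "fst (?g u) \<noteq> fst (?g v)"
      using ext[OF gc(1)] v(1) c(2) unfolding external_def by (metis image_eqI inj_onD)
    moreover have "cmap D (?g u) = cmap D (?g v)" using const[OF gc(1)] v(1) c(2) by auto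
    moreover have "?g v \<in> points ?n"
      using C(2)[OF gc(1)] v(1) by auto
    moreover have "(i, x) \<in> points ?n" "(i, y) \<in> points ?n" using i xy by (auto simp: points_def)
    moreover have triple: "\<And>p q r. \<lbrakk>p \<in> points ?n; q \<in> points ?n; r \<in> points ?n; p \<noteq> q; q \<noteq> r; p \<noteq> r;
        cmap D p = cmap D q\<rbrakk> \<Longrightarrow> cmap D q \<noteq> cmap D r"
      using gp unfolding general_position_def by blast
    ultimately show ?thesis
      using triple[of "(i, x)" "(i, y)" "?g v"] xy(3,4) by (metis fst_conv snd_conv)
  qed
  have "finite ?L"
  proof (rule finite_imageD)
    show "finite ((`) ?g ` ?L)" by (rule finite_subset[OF _ C(1)]) auto
    show "inj_on ((`) ?g) ?L"
      by (rule inj_onI) (use inj in \<open>auto simp: inj_on_image_eq_iff\<close>)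
  qed
  moreover have "card ?d = 2" by simp
  moreover have "disjnt ?d c" if "c \<in> ?L" for c
    using not_base[OF that] base by (auto simp: disjnt_def)
  moreover have "disjnt c c'" if c: "c \<in> ?L" "c' \<in> ?L" "c \<noteq> c'" for c c'
  proof -
    have "?g ` c \<noteq> ?g ` c'" using inj_on_image_eq_iff[OF inj, of c c'] c by auto
    then have "disjnt (?g ` c) (?g ` c')" using c C(3) by (auto simp: pairwise_def)
    then show ?thesis by (auto simp: disjnt_def)
  qed
  ultimately have sys: "chord_system (?n + 1) (insert ?d ?L)"
    using base_in unfolding chord_system_def pairwise_insert
    by (auto simp: disjnt_sym pairwise_def)
  have loop: "smooth_loop F A (\<lambda>z. cmap D (?g (j, z)))" if j: "j \<in> {1..?n + 1}" for j
  proof -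
    consider "j < i" | "j = i" | "j = i + 1" | "i + 1 < j" by linarith
    then show ?thesis
    proof cases
      case 1
      then show ?thesis using loops[of j] i j by (simp add: unsplit_point_def)
    next
      case 2
      then show ?thesis
        using smooth_loop_arc[OF A loops[OF i] xy(1,2,4)] by (simp add: unsplit_point_def)
    next
      case 3
      then show ?thesis
        using smooth_loop_arc[OF A loops[OF i] xy(2,1) xy(4)[symmetric]] by (simp add: unsplit_point_def)
    next
      case 4
      then have "j - 1 \<in> {1..?n}" using i j by auto
      with 4 show ?thesis using loops[of "j - 1"] by (simp add: unsplit_point_def)
    qed
  qed
  have const': "cmap D (?g u) = cmap D (?g v)" if c: "c \<in> insert ?d ?L" "u \<in> c" "v \<in> c" for c u v
  proof (cases "c = ?d")
    case True
    then have "cmap D (?g w) = cmap D (i, x)" if "w \<in> c" for w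
      using that base xy(4) by auto
    from this[OF c(2)] this[OF c(3)] show ?thesis by simp
  next
    case False
    with c(1) have "?g ` c \<in> chords D" by simp
    from const[OF this imageI[OF c(2)] imageI[OF c(3)]] show ?thesis .
  qed
  have "geometrical F A (split_diagram D i x y)"
    unfolding geometrical_def split_diagram_def diagram.simps o_def
    by (intro conjI ballI; (rule sys loop const'; assumption)?)
  moreover have "external c" if c: "c \<in> insert ?d ?L" for c
  proof (cases "c = ?d")
    case True
    then show ?thesis by (auto simp: external_def)
  next
    case False
    with c have ic: "inj_on fst (?g ` c)" and sub: "c \<subseteq> points (?n + 1)"
      using ext by (auto simp: external_def)
    show ?thesis
      unfolding external_def
    proof (rule inj_onI)
      \<comment> \<open>Equal labels after the splitting come from equal labels before it, so an
        external chord cannot acquire two endpoints on one circle.\<close>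
      fix u v assume u: "u \<in> c" and v: "v \<in> c" and "fst u = fst v"
      then have "fst (?g u) = fst (?g v)" by (simp only: fst_unsplit_point)
      from inj_onD[OF ic this imageI[OF u] imageI[OF v]]
      show "u = v" by (rule inj_onD[OF inj _ subsetD[OF sub u] subsetD[OF sub v]])
    qed
  qed
  ultimately show ?thesis
    unfolding ext_geometrical_def by (simp add: split_diagram_def)
qed

section \<open>Exchanging two labels\<close>

text \<open>\<open>swap_labels\<close> pushes chords forward along this map but pulls
  \<open>cmap\<close> back along it. The two are compatible because the map is an
  involution.\<close>

definition swap_point :: "nat \<Rightarrow> point \<Rightarrow> point" where
  "swap_point i = map_prod (Transposition.transpose i (i + 1)) id"

lemma swap_point_swap_point [simp]: "swap_point i (swap_point i u) = u"
  by (cases u) (simp add: swap_point_def)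

lemma swap_point_comp [simp]: "swap_point i \<circ> swap_point i = id"
  by (simp add: fun_eq_iff)

lemma inj_swap_point: "inj_on (swap_point i) S"
  by (rule inj_on_inverseI[of _ "swap_point i"]) simp

lemma image_swap_point_image [simp]: "swap_point i ` swap_point i ` S = S"
  by (simp add: image_image)

lemma swap_labels_eq:
  "swap_labels i D =
     (if i + 1 \<le> ncirc D
      then \<lparr>ncirc = ncirc D, chords = (`) (swap_point i) ` chords D, cmap = cmap D \<circ> swap_point i\<rparr>
      else D)"
  by (simp add: swap_labels_def swap_point_def)

lemma swap_labels_swap_labels [simp]: "swap_labels i (swap_labels i D) = D"
  by (cases D) (simp add: swap_labels_eq image_image comp_assoc)

lemma tau_class_tau_class: "tau_class i (tau_class i X) = X"
  by (simp add: tau_class_def image_image)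

lemma swap_point_in_points:
  assumes "1 \<le> i" "i + 1 \<le> n"
  shows "swap_point i u \<in> points n \<longleftrightarrow> u \<in> points n"
  using assms
  by (cases u) (auto simp: swap_point_def points_def Transposition.transpose_def)

lemma swap_point_image_points:
  assumes "1 \<le> i" "i + 1 \<le> n"
  shows "swap_point i ` c \<subseteq> points n \<longleftrightarrow> c \<subseteq> points n"
  using swap_point_in_points[OF assms] by auto

text \<open>Stated for separate components so that it applies to each stage of a homotopy as well as
  to a single diagram.\<close>

lemma geometrical_swap:
  assumes i: "1 \<le> i" "i + 1 \<le> n" and D: "geometrical F A \<lparr>ncirc = n, chords = C, cmap = f\<rparr>"
  shows "geometrical F A \<lparr>ncirc = n, chords = (`) (swap_point i) ` C, cmap = f \<circ> swap_point i\<rparr>"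
  unfolding geometrical_def
proof (intro conjI ballI; simp only: diagram.simps)
  have C: "finite C" "\<And>c. c \<in> C \<Longrightarrow> c \<subseteq> points n \<and> card c = 2" "pairwise disjnt C"
    using D by (auto simp: geometrical_def chord_system_def)
  have "disjnt (swap_point i ` c) (swap_point i ` d)" if "disjnt c d" for c d
    using that by (simp add: disjnt_def image_Int[OF inj_swap_point, symmetric])
  then show "chord_system n ((`) (swap_point i) ` C)"
    using C unfolding chord_system_def pairwise_image
    by (auto simp: swap_point_image_points[OF i] swap_point_in_points[OF i]
        card_image[OF inj_swap_point] pairwise_def)
next
  fix j assume "j \<in> {1..n}"
  then have "Transposition.transpose i (i + 1) j \<in> {1..n}"
    using i by (auto simp: Transposition.transpose_def)
  then show "smooth_loop F A (\<lambda>z. (f \<circ> swap_point i) (j, z))"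
    using D by (simp add: geometrical_def swap_point_def)
next
  fix c u v assume c: "c \<in> (`) (swap_point i) ` C" "u \<in> c" "v \<in> c"
  then obtain d where "d \<in> C" "swap_point i u \<in> d" "swap_point i v \<in> d" by auto
  moreover have "\<forall>c\<in>C. \<forall>u\<in>c. \<forall>v\<in>c. f u = f v"
    using D unfolding geometrical_def diagram.simps by (elim conjE)
  ultimately show "(f \<circ> swap_point i) u = (f \<circ> swap_point i) v" unfolding o_apply by blast
qed

lemma ext_geometrical_swap_labels:
  assumes "1 \<le> i" "ext_geometrical F A D"
  shows "ext_geometrical F A (swap_labels i D)"
proof (cases "i + 1 \<le> ncirc D")
  case True
  have "geometrical F A (swap_labels i D)"
    using geometrical_swap[OF assms(1) True, of F A "chords D" "cmap D"] True assms(2)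
    by (cases D) (simp add: swap_labels_eq ext_geometrical_def)
  moreover have "external (swap_point i ` c)" if "external c" for c
  proof -
    have "fst \<circ> swap_point i = Transposition.transpose i (i + 1) \<circ> fst"
      by (simp add: fun_eq_iff swap_point_def)
    moreover have "inj_on (Transposition.transpose i (i + 1) \<circ> fst) c"
      using that by (intro comp_inj_on inj_on_inverseI[of _ "Transposition.transpose i (i + 1)"])
        (simp_all add: external_def)
    ultimately show ?thesis unfolding external_def by (intro inj_on_imageI) simp
  qed
  ultimately show ?thesis using True assms(2) by (auto simp: ext_geometrical_def swap_labels_eq)
qed (use assms(2) in \<open>simp add: swap_labels_eq\<close>)

lemma homotopic_swap_labels:
  assumes "1 \<le> i" "homotopic_diagrams F A D D'"
  shows "homotopic_diagrams F A (swap_labels i D) (swap_labels i D')"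
proof (cases "i + 1 \<le> ncirc D")
  case True
  let ?s = "swap_point i"
  obtain H e where n: "ncirc D' = ncirc D"
    and st: "\<forall>t\<in>{0..1::real}. inj_on (e t) (\<Union>(chords D)) \<and>
       geometrical F A \<lparr>ncirc = ncirc D, chords = (`) (e t) ` chords D, cmap = H t\<rparr>"
    and ct: "\<forall>u\<in>\<Union>(chords D). continuous_on {0..1::real} (\<lambda>t. e t u)"
    and H: "\<forall>j\<in>{1..ncirc D}.
           continuous_map (prod_topology (top_of_set {0..1}) (top_of_set circle)) F
             (\<lambda>(t, z). H t (j, z))"
    and e0: "\<forall>u\<in>\<Union>(chords D). e 0 u = u"
    and H0: "\<forall>u\<in>points (ncirc D). H 0 u = cmap D u"
    and e1: "(`) (e 1) ` chords D = chords D'"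
    and H1: "\<forall>u\<in>points (ncirc D). H 1 u = cmap D' u"
    using assms(2) unfolding homotopic_diagrams_def by (elim conjE exE) (rule that; assumption)
  \<comment> \<open>The endpoint motion is conjugated by the swap, since both its argument and its
    value are points of a relabelled diagram; the maps into the surface are only precomposed with
    it.\<close>
  let ?e = "\<lambda>t. ?s \<circ> e t \<circ> ?s" and ?H = "\<lambda>t. H t \<circ> ?s"
  have un: "?s u \<in> \<Union>(chords D)" if "u \<in> \<Union>((`) ?s ` chords D)" for u
    using that by auto
  have im: "(`) (?e t) ` (`) ?s ` chords D = (`) ?s ` (`) (e t) ` chords D" for t
    by (simp add: image_image)
  have stage: "inj_on (?e t) (\<Union>((`) ?s ` chords D)) \<and> geometrical F A
      \<lparr>ncirc = ncirc D, chords = (`) (?e t) ` (`) ?s ` chords D, cmap = ?H t\<rparr>"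
    if "t \<in> {0..1}" for t
  proof
    have "?s ` \<Union>((`) ?s ` chords D) = \<Union>(chords D)" by (simp add: image_Union image_image)
    with conjunct1[OF bspec[OF st that]] show "inj_on (?e t) (\<Union>((`) ?s ` chords D))"
      by (intro comp_inj_on inj_swap_point) simp
    show "geometrical F A
      \<lparr>ncirc = ncirc D, chords = (`) (?e t) ` (`) ?s ` chords D, cmap = ?H t\<rparr>"
      unfolding im by (rule geometrical_swap[OF assms(1) True conjunct2[OF bspec[OF st that]]])
  qed
  have cont: "continuous_on {0..1} (\<lambda>t. ?e t u)" if "u \<in> \<Union>((`) ?s ` chords D)" for u
  proof -
    have "continuous_on UNIV ?s"
      unfolding swap_point_def map_prod_def case_prod_unfold id_def
      by (intro continuous_on_Pair continuous_on_compose2[OF _ continuous_on_fst[OF continuous_on_id]]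
          continuous_on_snd continuous_on_id) (auto simp: continuous_on_discrete)
    from continuous_on_compose2[OF this bspec[OF ct un[OF that]]] show ?thesis by simp
  qed
  have Hc: "continuous_map (prod_topology (top_of_set {0..1}) (top_of_set circle)) F
     (\<lambda>(t, z). ?H t (j, z))" if "j \<in> {1..ncirc D}" for j
  proof -
    have "Transposition.transpose i (i + 1) j \<in> {1..ncirc D}"
      using assms(1) True that by (auto simp: Transposition.transpose_def)
    from bspec[OF H this] show ?thesis by (simp add: swap_point_def)
  qed
  have eq0: "?e 0 u = u" if "u \<in> \<Union>((`) ?s ` chords D)" for u
    using bspec[OF e0 un[OF that]] by simp
  have HH: "?H 0 u = (cmap D \<circ> ?s) u" "?H 1 u = (cmap D' \<circ> ?s) u" if "u \<in> points (ncirc D)" for u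
    using bspec[OF H0, of "?s u"] bspec[OF H1, of "?s u"] that swap_point_in_points[OF assms(1) True]
    by auto
  have sD: "ncirc (swap_labels i D) = ncirc D" "chords (swap_labels i D) = (`) ?s ` chords D"
    "cmap (swap_labels i D) = cmap D \<circ> ?s"
    and sD': "ncirc (swap_labels i D') = ncirc D" "chords (swap_labels i D') = (`) ?s ` chords D'"
    "cmap (swap_labels i D') = cmap D' \<circ> ?s"
    using True n by (simp_all add: swap_labels_eq)
  show ?thesis
    unfolding homotopic_diagrams_def sD sD'
  proof (intro conjI exI[of _ ?H] exI[of _ ?e] ballI)
    show "(`) (?e 1) ` (`) ?s ` chords D = (`) ?s ` chords D'" unfolding im e1 ..
  qed (rule refl stage[THEN conjunct1] stage[THEN conjunct2] cont Hc eq0 HH; assumption)+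
next
  case False
  moreover have "ncirc D' = ncirc D" using assms(2) by (simp add: homotopic_diagrams_def)
  ultimately show ?thesis using assms(2) by (simp add: swap_labels_eq)
qed

text \<open>Relabelling a homotopy gives one inclusion. For the other, the homotopy is relabelled
  back, which is possible because \<open>swap_labels i\<close> is an involution.\<close>

lemma tau_class_diagram_class:
  assumes "1 \<le> i"
  shows "tau_class i (diagram_class F A D) = diagram_class F A (swap_labels i D)"
proof
  show "tau_class i (diagram_class F A D) \<subseteq> diagram_class F A (swap_labels i D)"
    using homotopic_swap_labels[OF assms] by (auto simp: tau_class_def diagram_class_def)
  have "D' \<in> tau_class i (diagram_class F A D)" if "homotopic_diagrams F A (swap_labels i D) D'" for D'
    unfolding tau_class_def diagram_class_def
    by (rule image_eqI[of _ _ "swap_labels i D'"])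
      (use homotopic_swap_labels[OF assms that] in simp_all)
  then show "diagram_class F A (swap_labels i D) \<subseteq> tau_class i (diagram_class F A D)"
    by (auto simp: diagram_class_def)
qed

section \<open>Relabelling of split diagrams\<close>

lemma unsplit_point_swap_point: "unsplit_point i x y (swap_point i u) = unsplit_point i y x u"
  by (cases u) (auto simp: unsplit_point_def swap_point_def Transposition.transpose_def)

text \<open>This is the source of the sign: \<open>S_plus\<close> and \<open>S_minus\<close> differ
  only in the order of \<open>x\<close> and \<open>y\<close>, so the swap interchanges them. The
  added chord is preserved because both of its endpoints sit at the base point 1.\<close>

lemma swap_labels_split_diagram:
  assumes "i \<in> {1..ncirc D}"
  shows "swap_labels i (split_diagram D i x y) = split_diagram D i y x"
proof -
  let ?s = "swap_point i"
  let ?L = "\<lambda>x y. {c. c \<subseteq> points (ncirc D + 1) \<and> card c = 2 \<and> unsplit_point i x y ` c \<in> chords D}"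
  \<comment> \<open>Splitting adds one circle, so the label \<open>i + 1\<close> exists and
    \<open>swap_labels\<close> does not fall into its identity branch.\<close>
  have i: "1 \<le> i" "i + 1 \<le> ncirc D + 1" using assms by auto
  have L: "?s ` c \<in> ?L y x" if "c \<in> ?L x y" for c x y
    using that
    by (simp add: swap_point_image_points[OF i, simplified] card_image[OF inj_swap_point] image_image
        unsplit_point_swap_point)
  have "(`) ?s ` ?L x y = ?L y x"
  proof
    show "?L y x \<subseteq> (`) ?s ` ?L x y"
    proof
      fix c assume "c \<in> ?L y x"
      from L[OF this] show "c \<in> (`) ?s ` ?L x y" by (rule image_eqI[rotated]) simp
    qed
  qed (use L in blast)
  moreover have "?s ` {(i, 1), (i + 1, 1)} = {(i, 1), (i + 1, 1)}"
    by (auto simp: swap_point_def)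
  moreover have "unsplit_point i x y \<circ> ?s = unsplit_point i y x"
    by (simp add: fun_eq_iff unsplit_point_swap_point)
  ultimately show ?thesis
    using i by (simp add: swap_labels_eq split_diagram_def comp_assoc)
qed

section \<open>Relabelling of slides\<close>

lemma swap_labels_move_endpoint:
  assumes "i + 1 \<le> ncirc D"
  shows "swap_labels i (move_endpoint D d u v) =
    move_endpoint (swap_labels i D) (swap_point i ` d) (swap_point i u) (swap_point i v)"
proof -
  \<comment> \<open>Set differences occur at two levels, points removed from a chord and chords
    removed from a diagram; images commute with each of them by injectivity at that level.\<close>
  have "inj ((`) (swap_point i))" by (rule inj_on_inverseI[of _ "(`) (swap_point i)"]) simp
  then show ?thesis
    using assms
    by (simp add: swap_labels_eq move_endpoint_def image_set_diff[OF inj_swap_point] image_set_diff)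
qed

lemma swap_point_Pair: "swap_point i (j, z) = (Transposition.transpose i (i + 1) j, z)"
  by (simp add: swap_point_def)

lemma cmap_swap_labels:
  "i + 1 \<le> ncirc D \<Longrightarrow> cmap (swap_labels i D) (swap_point i u) = cmap D u"
  by (simp add: swap_labels_eq)

lemma chords_swap_labels_Int:
  assumes "i + 1 \<le> ncirc D"
  shows "\<Union>(chords (swap_labels i D)) \<inter> swap_point i ` S = swap_point i ` (\<Union>(chords D) \<inter> S)"
  using assms by (simp add: swap_labels_eq image_Int[OF inj_swap_point] image_Union)

lemma swap_point_image_Times: "swap_point i ` ({j} \<times> B) = {Transposition.transpose i (i + 1) j} \<times> B"
  by (auto simp: swap_point_Pair image_iff)

text \<open>The witnesses are those of the original slide with labels transposed. Positions on a
  circle and the arc \<open>B\<close> are unchanged, because the swap leaves the circle coordinate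
  alone.\<close>

lemma slide_past_swap_labels:
  assumes "slide_past D D'"
  shows "slide_past (swap_labels i D) (swap_labels i D')"
proof (cases "i + 1 \<le> ncirc D")
  case True
  let ?s = "swap_point i" and ?t = "Transposition.transpose i (i + 1)"
  obtain c d j x z z' B where h: "c \<in> chords D" "d \<in> chords D" "B \<in> arcs z z'" "c \<noteq> d" "(j, x) \<in> c" "(j, z) \<in> d"
    "z' \<in> circle" "z' \<noteq> x" "z' \<noteq> z" "\<Union>(chords D) \<inter> ({j} \<times> B) = {(j, x), (j, z)}"
    "\<forall>w\<in>B. cmap D (j, w) = cmap D (j, x)" "D' = move_endpoint D d (j, z) (j, z')"
    using assms unfolding slide_past_def by blast
  show ?thesis
    unfolding slide_past_def
  proof (rule bexI[of _ "?s ` c"], rule bexI[of _ "?s ` d"], rule exI[of _ "?t j"],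
      rule exI[of _ x], rule exI[of _ z], rule exI[of _ "z'"], rule bexI[of _ B], intro conjI)
    show "?s ` c \<in> chords (swap_labels i D)" "?s ` d \<in> chords (swap_labels i D)"
      using h True by (auto simp: swap_labels_eq)
    show "?s ` c \<noteq> ?s ` d" using h(4) by (metis image_swap_point_image)
    show "(?t j, x) \<in> ?s ` c" "(?t j, z) \<in> ?s ` d" using h(5,6) by (force simp: swap_point_Pair)+
    show "\<Union>(chords (swap_labels i D)) \<inter> ({?t j} \<times> B) = {(?t j, x), (?t j, z)}"
      using chords_swap_labels_Int[OF True, of "{j} \<times> B"] h(10)
      by (simp add: swap_point_image_Times swap_point_Pair)
    show "\<forall>w\<in>B. cmap (swap_labels i D) (?t j, w) = cmap (swap_labels i D) (?t j, x)"
      using h(11) cmap_swap_labels[OF True, of "(j, _)"] by (simp add: swap_point_Pair)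
    show "swap_labels i D' = move_endpoint (swap_labels i D) (?s ` d) (?t j, z) (?t j, z')"
      using swap_labels_move_endpoint[OF True] h(12) by (simp add: swap_point_Pair)
  qed (use h in auto)
next
  case False
  moreover have "ncirc D' = ncirc D"
    using assms unfolding slide_past_def move_endpoint_def by auto
  ultimately show ?thesis using assms by (simp add: swap_labels_eq)
qed

text \<open>As for sliding past, with both labels \<open>j\<close> and \<open>k\<close> transposed;
  they remain distinct because a transposition is injective.\<close>

lemma slide_along_swap_labels:
  assumes "slide_along D D'"
  shows "slide_along (swap_labels i D) (swap_labels i D')"
proof (cases "i + 1 \<le> ncirc D")
  case True
  let ?s = "swap_point i" and ?t = "Transposition.transpose i (i + 1)"
  obtain c d j x z k y z' B B' where D': "D' = move_endpoint D d (j, z) (k, z')"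
    and c: "c = {(j, x), (k, y)}" and B: "B \<in> arcs x z" "B' \<in> arcs y z'"
    and cd: "c \<in> chords D" "d \<in> chords D" "c \<noteq> d"
    and jk: "j \<noteq> k" "(j, z) \<in> d" "z' \<in> circle" "z' \<noteq> y"
    and free: "\<Union>(chords D) \<inter> ({j} \<times> B) = {(j, x), (j, z)}"
      "\<Union>(chords D) \<inter> ({k} \<times> B') = {(k, y)}"
    and const: "\<forall>w\<in>B. cmap D (j, w) = cmap D (j, x)" "\<forall>w\<in>B'. cmap D (k, w) = cmap D (k, y)"
    using assms unfolding slide_along_def by (elim bexE exE conjE) (rule that; assumption)
  show ?thesis
    unfolding slide_along_def
  proof (rule bexI[of _ "?s ` c"], rule bexI[of _ "?s ` d"], rule exI[of _ "?t j"],
      rule exI[of _ x], rule exI[of _ z], rule exI[of _ "?t k"], rule exI[of _ y], rule exI[of _ "z'"],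
      rule bexI[of _ B], rule bexI[of _ "B'"], intro conjI)
    show "?s ` c \<in> chords (swap_labels i D)" "?s ` d \<in> chords (swap_labels i D)"
      using cd True by (auto simp: swap_labels_eq)
    show "?s ` c \<noteq> ?s ` d" using cd(3) by (metis image_swap_point_image)
    show "?s ` c = {(?t j, x), (?t k, y)}" using c by (simp add: swap_point_Pair)
    show "?t j \<noteq> ?t k" using jk(1) by (metis Transposition.transpose_involutory)
    show "(?t j, z) \<in> ?s ` d" using jk(2) by (force simp: swap_point_Pair)
    show "\<Union>(chords (swap_labels i D)) \<inter> ({?t j} \<times> B) = {(?t j, x), (?t j, z)}"
      using chords_swap_labels_Int[OF True, of "{j} \<times> B"] free(1)
      by (simp add: swap_point_image_Times swap_point_Pair)
    show "\<Union>(chords (swap_labels i D)) \<inter> ({?t k} \<times> B') = {(?t k, y)}"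
      using chords_swap_labels_Int[OF True, of "{k} \<times> B'"] free(2)
      by (simp add: swap_point_image_Times swap_point_Pair)
    show "\<forall>w\<in>B. cmap (swap_labels i D) (?t j, w) = cmap (swap_labels i D) (?t j, x)"
      using const(1) cmap_swap_labels[OF True, of "(j, _)"] by (simp add: swap_point_Pair)
    show "\<forall>w\<in>B'. cmap (swap_labels i D) (?t k, w) = cmap (swap_labels i D) (?t k, y)"
      using const(2) cmap_swap_labels[OF True, of "(k, _)"] by (simp add: swap_point_Pair)
    show "swap_labels i D' = move_endpoint (swap_labels i D) (?s ` d) (?t j, z) (?t k, z')"
      using swap_labels_move_endpoint[OF True] D' by (simp add: swap_point_Pair)
  qed (use B jk in auto)
next
  case False
  moreover have "ncirc D' = ncirc D"
    using assms unfolding slide_along_def move_endpoint_def by auto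
  ultimately show ?thesis using assms by (simp add: swap_labels_eq)
qed

section \<open>The quotient module\<close>

text \<open>\<open>tau\<close> takes images of cosets under this additive map, so computations with
  \<open>tau\<close> can be made on elements of the free module before passing to the
  quotient.\<close>

definition tau_frag :: "nat \<Rightarrow> ('f chord_diagram \<Rightarrow>\<^sub>0 int) \<Rightarrow> ('f chord_diagram \<Rightarrow>\<^sub>0 int)" where
  "tau_frag i = frag_extend (\<lambda>\<D>. frag_of (tau_class i \<D>))"

lemma tau_frag_simps [simp]:
  "tau_frag i 0 = 0" "tau_frag i (- m) = - tau_frag i m"
  "tau_frag i (m + m') = tau_frag i m + tau_frag i m'"
  "tau_frag i (m - m') = tau_frag i m - tau_frag i m'"
  "tau_frag i (frag_of \<D>) = frag_of (tau_class i \<D>)"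
  by (simp_all add: tau_frag_def frag_extend_minus frag_extend_add frag_extend_diff)

lemma tau_frag_tau_frag [simp]: "tau_frag i (tau_frag i m) = m"
  using subset_UNIV[of "Poly_Mapping.keys m"]
  by (induction m rule: frag_induction) (simp_all add: tau_class_tau_class)

lemma carrier_M_e:
  "carrier (M_e F A) = {m. Poly_Mapping.keys m \<subseteq> {diagram_class F A D | D. ext_geometrical F A D}}"
  by (auto simp: M_e_def)

lemma comm_group_M_e: "comm_group (M_e F A)"
  by (simp add: M_e_def abelian_free_Abelian_group)

lemma M_e_simps [simp]:
  "\<one>\<^bsub>M_e F A\<^esub> = 0" "m \<otimes>\<^bsub>M_e F A\<^esub> m' = m + m'"
  "m \<in> carrier (M_e F A) \<Longrightarrow> inv\<^bsub>M_e F A\<^esub> m = - m"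
  by (simp_all add: M_e_def)

lemma diff_in_M_e: "\<lbrakk>m \<in> carrier (M_e F A); m' \<in> carrier (M_e F A)\<rbrakk> \<Longrightarrow> m - m' \<in> carrier (M_e F A)"
  unfolding carrier_M_e using keys_diff[of m m'] by blast

lemma frag_of_in_M_e: "ext_geometrical F A D \<Longrightarrow> frag_of (diagram_class F A D) \<in> carrier (M_e F A)"
  by (auto simp: carrier_M_e)

lemma generators_N_e_in_M_e:
  "{frag_of (diagram_class F A D) - frag_of (diagram_class F A D') | D D'.
     ext_geometrical F A D \<and> ext_geometrical F A D' \<and> (slide_past D D' \<or> slide_along D D')}
   \<subseteq> carrier (M_e F A)"
  using diff_in_M_e[OF frag_of_in_M_e frag_of_in_M_e] by blast

lemma normal_N_e: "N_e F A \<lhd> M_e F A"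
proof -
  interpret comm_group "M_e F A" by (rule comm_group_M_e)
  show ?thesis
    unfolding N_e_def by (rule subgroup_imp_normal[OF generate_is_subgroup[OF generators_N_e_in_M_e]])
qed

text \<open>Relabelling turns each generating relation into a generating relation of the same kind,
  and additivity extends this to the generated subgroup.\<close>

lemma tau_frag_N_e:
  assumes "1 \<le> i" "m \<in> N_e F A"
  shows "tau_frag i m \<in> N_e F A"
proof -
  interpret comm_group "M_e F A" by (rule comm_group_M_e)
  let ?R = "{frag_of (diagram_class F A D) - frag_of (diagram_class F A D') | D D'.
     ext_geometrical F A D \<and> ext_geometrical F A D' \<and> (slide_past D D' \<or> slide_along D D')}"
  have R: "tau_frag i r \<in> ?R" if r: "r \<in> ?R" for r
  proof -
    obtain D D' where D: "r = frag_of (diagram_class F A D) - frag_of (diagram_class F A D')"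
      "ext_geometrical F A D" "ext_geometrical F A D'" "slide_past D D' \<or> slide_along D D'"
      using r by blast
    have "tau_frag i r =
        frag_of (diagram_class F A (swap_labels i D)) - frag_of (diagram_class F A (swap_labels i D'))"
      by (simp add: D(1) tau_class_diagram_class[OF assms(1)])
    with D(2-4) show ?thesis
      using ext_geometrical_swap_labels[OF assms(1)] slide_past_swap_labels slide_along_swap_labels
      by blast
  qed
  show ?thesis
    using assms(2) unfolding N_e_def
  proof (induction rule: generate.induct)
    case one
    then show ?case using generate.one[of "M_e F A" ?R] by simp
  next
    case (incl h)
    then show ?case by (rule generate.incl[OF R])
  next
    case (inv h)
    \<comment> \<open>The inverse in \<open>M_e\<close> is known to be negation only on the carrier,
      so both \<open>h\<close> and its image are placed there first.\<close>
    have "h \<in> carrier (M_e F A)" "tau_frag i h \<in> carrier (M_e F A)"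
      using inv R[OF inv] generators_N_e_in_M_e by blast+
    then show ?case using generate.inv[OF R[OF inv], of "M_e F A"] by simp
  next
    case (eng g h)
    from generate.eng[OF eng.IH] show ?case by simp
  qed
qed

text \<open>For an involution, mapping the subgroup into itself already means mapping it onto
  itself. Hence the image of a coset is a whole coset and not just part of one.\<close>

lemma tau_frag_image_N_e: "1 \<le> i \<Longrightarrow> tau_frag i ` N_e F A = N_e F A"
  by (auto intro!: tau_frag_N_e image_eqI[of _ _ "tau_frag i _"])

text \<open>Passing from negatives of elements to inverses in the quotient requires representatives
  in the carrier, hence split diagrams that are geometrical with only external chords.\<close>

lemma mu_diagram_in_M_e:
  assumes "oriented_surface F A" "ext_geometrical F A D" "general_position A D"
  shows "mu_diagram F A i D \<in> carrier (M_e F A)"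
proof -
  interpret comm_group "M_e F A" by (rule comm_group_M_e)
  have A: "\<forall>(U, \<psi>)\<in>A. openin F U" using assms(1) by (auto simp: oriented_surface_def)
  have "frag_of (diagram_class F A (S_plus D i x y)) - frag_of (diagram_class F A (S_minus D i x y))
      \<in> carrier (M_e F A)" if "(x, y) \<in> SI\<^sub>0 F A D i" for x y
  proof -
    from that have xy: "i \<in> {1..ncirc D}" "x \<in> circle" "y \<in> circle" "x \<noteq> y" "cmap D (i, x) = cmap D (i, y)"
      by (auto simp: SI\<^sub>0_def self_intersections_def)
    show ?thesis
      unfolding S_plus_def S_minus_def
      by (intro diff_in_M_e frag_of_in_M_e ext_geometrical_split_diagram[OF A assms(2,3)] xy
          xy(4)[symmetric] xy(5)[symmetric])
  qed
  then show ?thesis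
    unfolding mu_diagram_def M_e_def by (intro sum_closed_free_Abelian_group) auto
qed

lemma tau_frag_mu_diagram:
  assumes "1 \<le> i"
  shows "tau_frag i (mu_diagram F A i D) = - mu_diagram F A i D"
proof (cases "finite (SI\<^sub>0 F A D i)")
  case True
  have "tau_frag i (frag_of (diagram_class F A (S_plus D i x y)) - frag_of (diagram_class F A (S_minus D i x y)))
      = - (frag_of (diagram_class F A (S_plus D i x y)) - frag_of (diagram_class F A (S_minus D i x y)))"
    if "(x, y) \<in> SI\<^sub>0 F A D i" for x y
  proof -
    have "i \<in> {1..ncirc D}" using that by (auto simp: SI\<^sub>0_def self_intersections_def)
    then show ?thesis
      by (simp add: tau_class_diagram_class[OF assms] S_plus_def S_minus_def swap_labels_split_diagram)
  qed
  then show ?thesis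
    unfolding mu_diagram_def tau_frag_def frag_extend_sum[OF True] sum_negf[symmetric]
    by (intro sum.cong) (auto simp flip: tau_frag_def)
\<comment> \<open>A sum over an infinite index set is 0 by convention, and 0 is its own
  negative.\<close>
qed (simp add: mu_diagram_def)

theorem proposition5p1:
  fixes F :: "'f topology" and A :: "'f atlas" and i :: nat
  assumes "oriented_surface F A" and "1 \<le> i"
  shows "\<forall>X\<in>carrier (ch_e F A). (tau i \<circ> mu F A i) X = inv\<^bsub>ch_e F A\<^esub> (mu F A i X)"
proof
  fix X assume X: "X \<in> carrier (ch_e F A)"
  interpret comm_group "M_e F A" by (rule comm_group_M_e)
  interpret N: normal "N_e F A" "M_e F A" by (rule normal_N_e)
  \<comment> \<open>This repeats the choice made in \<open>mu\<close>; since \<open>X\<close> is a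
    coset and so nonempty, it yields an actual element of \<open>X\<close>.\<close>
  define m where "m = (SOME m. m \<in> X)"
  obtain m\<^sub>0 where "m\<^sub>0 \<in> carrier (M_e F A)" "X = N_e F A #>\<^bsub>M_e F A\<^esub> m\<^sub>0"
    using X by (auto simp: ch_e_def carrier_FactGroup)
  then have "m\<^sub>0 \<in> X" "X \<subseteq> carrier (M_e F A)"
    using rcos_self[OF _ N.subgroup_axioms] r_coset_subset_G[OF N.subset] by auto
  then have m: "m \<in> carrier (M_e F A)" unfolding m_def by (metis someI subsetD)
  define a where "a = frag_extend (mu_class F A i) m"
  have mu_class: "mu_class F A i \<D> \<in> carrier (M_e F A)" if \<D>: "\<D> \<in> Poly_Mapping.keys m" for \<D>
  proof (cases "\<exists>D\<in>\<D>. general_position A D")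
    case True
    define D where "D = (SOME D. D \<in> \<D> \<and> general_position A D)"
    have D: "D \<in> \<D>" "general_position A D"
      using someI_ex True unfolding D_def by (metis (mono_tags, lifting))+
    \<comment> \<open>Membership of \<open>m\<close> in \<open>M_e\<close> only provides some
      representative with external chords; the chosen representative in general position inherits
      this along a homotopy.\<close>
    obtain D\<^sub>0 where "\<D> = diagram_class F A D\<^sub>0" "ext_geometrical F A D\<^sub>0"
      using m \<D> by (auto simp: carrier_M_e)
    then have "ext_geometrical F A D"
      using D(1) homotopic_ext_geometrical by (auto simp: diagram_class_def)
    with D(2) True show ?thesis
      using mu_diagram_in_M_e[OF assms(1)] by (simp add: mu_class_def D_def)
  qed (simp add: mu_class_def carrier_M_e)
  have a: "a \<in> carrier (M_e F A)"
    using keys_frag_extend[of "mu_class F A i" m] mu_class unfolding a_def carrier_M_e by blast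
  \<comment> \<open>The sign change holds for the chosen representatives themselves, in the free
    module; it also covers the default value 0 of \<open>mu_class\<close>.\<close>
  have tau_mu: "tau_frag i (mu_class F A i \<D>) = - mu_class F A i \<D>" for \<D>
    by (simp add: mu_class_def tau_frag_mu_diagram[OF assms(2)])
  have "tau_frag i (frag_extend (mu_class F A i) m) = - frag_extend (mu_class F A i) m" for m
    using subset_UNIV[of "Poly_Mapping.keys m"]
    by (induction m rule: frag_induction) (simp_all add: frag_extend_diff tau_mu)
  then have ta: "tau_frag i a = - a" unfolding a_def .
  have mu: "mu F A i X = N_e F A #>\<^bsub>M_e F A\<^esub> a" by (simp add: mu_def a_def m_def)
  have coset: "N_e F A #>\<^bsub>M_e F A\<^esub> b = (\<lambda>h. h + b) ` N_e F A" for b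
    by (auto simp: r_coset_def)
  have "(tau i \<circ> mu F A i) X = tau_frag i ` (N_e F A #>\<^bsub>M_e F A\<^esub> a)"
    by (simp add: mu tau_def tau_frag_def)
  \<comment> \<open>By additivity the coset of \<open>a\<close> is mapped to the translate of the
    image of \<open>N_e\<close> by \<open>tau_frag i a\<close>, which is \<open>- a\<close>.\<close>
  also have "\<dots> = (\<lambda>h. h + - a) ` tau_frag i ` N_e F A"
    unfolding coset image_image by (simp add: ta)
  also have "\<dots> = N_e F A #>\<^bsub>M_e F A\<^esub> (- a)"
    by (simp add: tau_frag_image_N_e[OF assms(2)] coset)
  also have "\<dots> = inv\<^bsub>ch_e F A\<^esub> (mu F A i X)"
    using a N.inv_FactGroup[of "mu F A i X"] N.rcos_inv[OF a]
    by (simp add: ch_e_def mu carrier_FactGroup)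
  finally show "(tau i \<circ> mu F A i) X = inv\<^bsub>ch_e F A\<^esub> (mu F A i X)" .
qed

end
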